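(* A planar st-graph $G$ admits an upward-planar L-drawing if and only if it admits a bitonic pair, and it admits an upward-rightward-planar L-drawing if and only if it admits a monotonically decreasing pair.
   Context: An L-drawing of a directed graph $G=(V,E)$ assigns to each vertex a point of the plane with integer coordinates such that no two vertices share an $x$-coordinate or a $y$-coordinate, and draws each directed edge $(u,v)$ as a one-bend orthogonal polyline consisting of a vertical segment incident to $u$ followed by a horizontal segment incident to $v$. Drawings of distinct edges may partially overlap and may cross; bends and crossings are distinguished by regarding each bend as a small rounded junction. An L-drawing is planar if no two edges cross (overlaps are allowed). A planar L-drawing is upward-planar if every edge is $y$-monotone (increasing in $y$ from tail to head), and upward-rightward-planar if every edge is both $x$-monotone and $y$-monotone (increasing in both $x$ and $y$ from tail to head). A planar st-graph is a directed acyclic graph with a single source $s$ and a single sink $t$ that admits a planar embedding with $s$ and $t$ on the boundary of the same face. An upward-planar embedding $\mathcal E$ of $G$ is the embedding (cyclic edge orders around vertices and outer face) of a planar drawing of $G$ in which every edge is a $y$-monotone curve increasing from tail to head; for a vertex $v$, $S(v)=\langle v_1,\dots,v_k\rangle$ denotes the list of successors of $v$ in the left-to-right order in which they appear around $v$ in $\mathcal E$. An st-ordering is an injective map $\pi:V\to\mathbb Z$ with $\pi(u)<\pi(v)$ for every edge $(u,v)$. $S(v)$ is monotonically decreasing w.r.t. $\pi$ if $\pi(v_i)>\pi(v_{i+1})$ for $i=1,\dots,k-1$, and bitonic w.r.t. $\pi$ if there is $h$ with $\pi(v_i)<\pi(v_{i+1})$ for $i=1,\dots,h-1$ and $\pi(v_i)>\pi(v_{i+1})$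 for $i=h,\dots,k-1$. A pair $\langle\mathcal E,\pi\rangle$ with $\mathcal E$ an upward-planar embedding of $G$ and $\pi$ an st-ordering is a bitonic pair (resp. monotonically decreasing pair) of $G$ if $S(v)$ is bitonic (resp. monotonically decreasing) w.r.t. $\pi$ for every vertex $v$. *)

theory Defs
  imports "HOL-Analysis.Analysis" "Graph_Theory.Pair_Digraph"
begin

section \<open>Planar drawings and planar st-graphs\<close>

text \<open>
  A drawing is a pair \<open>p\<close>, \<open>\<gamma>\<close> of vertex positions and edge curves in the plane
  \<open>real \<times> real\<close>; an edge \<open>(u, v)\<close> is directed from \<open>u\<close> to \<open>v\<close>.
\<close>

definition planar_drawing ::
  "'a pair_pre_digraph \<Rightarrow> ('a \<Rightarrow> real \<times> real) \<Rightarrow> ('a \<times> 'a \<Rightarrow> real \<Rightarrow> real \<times> real) \<Rightarrow> bool" where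
  "planar_drawing G p \<gamma> \<longleftrightarrow>
     inj_on p (pverts G) \<and>
     (\<forall>(u, v) \<in> parcs G.
        arc (\<gamma> (u, v)) \<and> pathstart (\<gamma> (u, v)) = p u \<and> pathfinish (\<gamma> (u, v)) = p v \<and>
        (\<forall>w \<in> pverts G. p w \<in> path_image (\<gamma> (u, v)) \<longrightarrow> w = u \<or> w = v)) \<and>
     (\<forall>(u, v) \<in> parcs G. \<forall>(w, z) \<in> parcs G. (u, v) \<noteq> (w, z) \<longrightarrow>
        path_image (\<gamma> (u, v)) \<inter> path_image (\<gamma> (w, z)) \<subseteq> p ` ({u, v} \<inter> {w, z}))"

definition drawing_image ::
  "'a pair_pre_digraph \<Rightarrow> ('a \<Rightarrow> real \<times> real) \<Rightarrow> ('a \<times> 'a \<Rightarrow> real \<Rightarrow> real \<times> real)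
     \<Rightarrow> (real \<times> real) set" where
  "drawing_image G p \<gamma> = p ` pverts G \<union> (\<Union>e \<in> parcs G. path_image (\<gamma> e))"

definition planar_st_graph :: "'a pair_pre_digraph \<Rightarrow> bool" where
  "planar_st_graph G \<longleftrightarrow>
     pair_fin_digraph G \<and> acyclic (parcs G) \<and>
     (\<exists>s t. {v \<in> pverts G. in_arcs (with_proj G) v = {}} = {s} \<and>
            {v \<in> pverts G. out_arcs (with_proj G) v = {}} = {t} \<and>
            (\<exists>p \<gamma>. planar_drawing G p \<gamma> \<and>
               (\<exists>F \<in> components (- drawing_image G p \<gamma>).
                  p s \<in> frontier F \<and> p t \<in> frontier F)))"


section \<open>Upward-planar embeddings\<close>

definition upward_planar_drawing ::
  "'a pair_pre_digraph \<Rightarrow> ('a \<Rightarrow> real \<times> real) \<Rightarrow> ('a \<times> 'a \<Rightarrow> real \<Rightarrow> real \<times> real) \<Rightarrow> bool" where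
  "upward_planar_drawing G p \<gamma> \<longleftrightarrow>
     planar_drawing G p \<gamma> \<and> (\<forall>e \<in> parcs G. strict_mono_on {0..1} (snd \<circ> \<gamma> e))"

text \<open>
  Let \<open>e\<close> and \<open>f\<close> both leave, or both enter, the vertex drawn at \<open>a\<close> in an upward drawing. Then
  on each horizontal line slightly above (respectively below) \<open>a\<close> there is exactly one point of
  each of the two curves, and \<open>e\<close> is left of \<open>f\<close> around \<open>a\<close> iff these points appear in that order.
\<close>

definition left_of_around ::
  "('a \<times> 'a \<Rightarrow> real \<Rightarrow> real \<times> real) \<Rightarrow> real \<times> real \<Rightarrow> 'a \<times> 'a \<Rightarrow> 'a \<times> 'a \<Rightarrow> bool" where
  "left_of_around \<gamma> a e f \<longleftrightarrow>
     (\<exists>\<epsilon>>0. \<forall>q \<in> path_image (\<gamma> e). \<forall>r \<in> path_image (\<gamma> f).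
        snd q = snd r \<and> 0 < \<bar>snd q - snd a\<bar> \<and> \<bar>snd q - snd a\<bar> < \<epsilon> \<longrightarrow> fst q < fst r)"

text \<open>
  In an upward drawing the outgoing edges of a vertex leave it upwards and the incoming ones
  enter it from below. So the clockwise cyclic order around \<open>v\<close> is \<open>succs \<E> v\<close> followed by
  \<open>rev (preds \<E> v)\<close>, where both lists are in left-to-right order. The field \<open>outer_face\<close> is the
  set of edges on the boundary of the outer face.
\<close>

record 'a upward_embedding =
  succs :: "'a \<Rightarrow> 'a list"
  preds :: "'a \<Rightarrow> 'a list"
  outer_face :: "('a \<times> 'a) set"

definition induces_embedding ::
  "'a pair_pre_digraph \<Rightarrow> ('a \<Rightarrow> real \<times> real) \<Rightarrow> ('a \<times> 'a \<Rightarrow> real \<Rightarrow> real \<times> real)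
     \<Rightarrow> 'a upward_embedding \<Rightarrow> bool" where
  "induces_embedding G p \<gamma> \<E> \<longleftrightarrow>
     (\<forall>v \<in> pverts G.
        distinct (succs \<E> v) \<and> set (succs \<E> v) = {w. (v, w) \<in> parcs G} \<and>
        sorted_wrt (\<lambda>w z. left_of_around \<gamma> (p v) (v, w) (v, z)) (succs \<E> v) \<and>
        distinct (preds \<E> v) \<and> set (preds \<E> v) = {u. (u, v) \<in> parcs G} \<and>
        sorted_wrt (\<lambda>u w. left_of_around \<gamma> (p v) (u, v) (w, v)) (preds \<E> v)) \<and>
     outer_face \<E> =
       {e \<in> parcs G. path_image (\<gamma> e) \<subseteq> frontier (outside (drawing_image G p \<gamma>))}"

definition upward_planar_embedding :: "'a pair_pre_digraph \<Rightarrow> 'a upward_embedding \<Rightarrow> bool" where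
  "upward_planar_embedding G \<E> \<longleftrightarrow>
     (\<exists>p \<gamma>. upward_planar_drawing G p \<gamma> \<and> induces_embedding G p \<gamma> \<E>)"


section \<open>Bitonic and monotonically decreasing pairs\<close>

definition st_ordering :: "'a pair_pre_digraph \<Rightarrow> ('a \<Rightarrow> int) \<Rightarrow> bool" where
  "st_ordering G \<pi> \<longleftrightarrow> inj_on \<pi> (pverts G) \<and> (\<forall>(u, v) \<in> parcs G. \<pi> u < \<pi> v)"

definition mono_decreasing :: "('a \<Rightarrow> int) \<Rightarrow> 'a list \<Rightarrow> bool" where
  "mono_decreasing \<pi> vs \<longleftrightarrow> (\<forall>i. Suc i < length vs \<longrightarrow> \<pi> (vs ! i) > \<pi> (vs ! Suc i))"

text \<open>Lists are indexed from 0, so \<open>h\<close> is the 0-based position of the maximum.\<close>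

definition bitonic :: "('a \<Rightarrow> int) \<Rightarrow> 'a list \<Rightarrow> bool" where
  "bitonic \<pi> vs \<longleftrightarrow>
     (\<exists>h. (\<forall>i. Suc i < length vs \<and> i < h \<longrightarrow> \<pi> (vs ! i) < \<pi> (vs ! Suc i)) \<and>
          (\<forall>i. Suc i < length vs \<and> h \<le> i \<longrightarrow> \<pi> (vs ! i) > \<pi> (vs ! Suc i)))"

definition bitonic_pair ::
  "'a pair_pre_digraph \<Rightarrow> 'a upward_embedding \<Rightarrow> ('a \<Rightarrow> int) \<Rightarrow> bool" where
  "bitonic_pair G \<E> \<pi> \<longleftrightarrow>
     upward_planar_embedding G \<E> \<and> st_ordering G \<pi> \<and>
     (\<forall>v \<in> pverts G. bitonic \<pi> (succs \<E> v))"

definition mono_decreasing_pair ::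
  "'a pair_pre_digraph \<Rightarrow> 'a upward_embedding \<Rightarrow> ('a \<Rightarrow> int) \<Rightarrow> bool" where
  "mono_decreasing_pair G \<E> \<pi> \<longleftrightarrow>
     upward_planar_embedding G \<E> \<and> st_ordering G \<pi> \<and>
     (\<forall>v \<in> pverts G. mono_decreasing \<pi> (succs \<E> v))"


section \<open>L-drawings\<close>

definition L_drawing :: "'a pair_pre_digraph \<Rightarrow> ('a \<Rightarrow> int) \<Rightarrow> ('a \<Rightarrow> int) \<Rightarrow> bool" where
  "L_drawing G x y \<longleftrightarrow> inj_on x (pverts G) \<and> inj_on y (pverts G)"

definition L_point :: "('a \<Rightarrow> int) \<Rightarrow> ('a \<Rightarrow> int) \<Rightarrow> 'a \<Rightarrow> real \<times> real" where
  "L_point x y v = (of_int (x v), of_int (y v))"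

definition L_bend :: "('a \<Rightarrow> int) \<Rightarrow> ('a \<Rightarrow> int) \<Rightarrow> 'a \<times> 'a \<Rightarrow> real \<times> real" where
  "L_bend x y e = (of_int (x (fst e)), of_int (y (snd e)))"

definition L_edge :: "('a \<Rightarrow> int) \<Rightarrow> ('a \<Rightarrow> int) \<Rightarrow> 'a \<times> 'a \<Rightarrow> real \<Rightarrow> real \<times> real" where
  "L_edge x y e =
     linepath (L_point x y (fst e)) (L_bend x y e) +++
     linepath (L_bend x y e) (L_point x y (snd e))"

text \<open>
  Two edges cross iff an interior point of the vertical segment of one of them is an interior
  point of the horizontal segment of the other. All other common points are harmless: since
  vertices have pairwise distinct \<open>x\<close>- and \<open>y\<close>-coordinates, collinear segments of distinct edges
  meet only at or along a common tail or head (an overlap); a bend lies on another edge only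
  if the two edges share their tail or their head, where the rounded bend merely joins the
  overlapping part; and an edge meets a vertex only at its own tail and head.
\<close>

definition L_cross :: "('a \<Rightarrow> int) \<Rightarrow> ('a \<Rightarrow> int) \<Rightarrow> 'a \<times> 'a \<Rightarrow> 'a \<times> 'a \<Rightarrow> bool" where
  "L_cross x y e f \<longleftrightarrow>
     open_segment (L_point x y (fst e)) (L_bend x y e) \<inter>
       open_segment (L_bend x y f) (L_point x y (snd f)) \<noteq> {} \<or>
     open_segment (L_point x y (fst f)) (L_bend x y f) \<inter>
       open_segment (L_bend x y e) (L_point x y (snd e)) \<noteq> {}"

definition planar_L_drawing :: "'a pair_pre_digraph \<Rightarrow> ('a \<Rightarrow> int) \<Rightarrow> ('a \<Rightarrow> int) \<Rightarrow> bool" where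
  "planar_L_drawing G x y \<longleftrightarrow>
     L_drawing G x y \<and> (\<forall>e \<in> parcs G. \<forall>f \<in> parcs G. e \<noteq> f \<longrightarrow> \<not> L_cross x y e f)"

text \<open>
  Monotonicity of the polyline is necessarily weak: its horizontal segment has constant
  \<open>y\<close>-coordinate and its vertical segment has constant \<open>x\<close>-coordinate. As the end vertices have
  distinct coordinates, the coordinate still increases strictly from tail to head.
\<close>

definition upward_planar_L_drawing ::
  "'a pair_pre_digraph \<Rightarrow> ('a \<Rightarrow> int) \<Rightarrow> ('a \<Rightarrow> int) \<Rightarrow> bool" where
  "upward_planar_L_drawing G x y \<longleftrightarrow>
     planar_L_drawing G x y \<and> (\<forall>e \<in> parcs G. mono_on {0..1} (snd \<circ> L_edge x y e))"

definition upward_rightward_planar_L_drawing ::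
  "'a pair_pre_digraph \<Rightarrow> ('a \<Rightarrow> int) \<Rightarrow> ('a \<Rightarrow> int) \<Rightarrow> bool" where
  "upward_rightward_planar_L_drawing G x y \<longleftrightarrow>
     planar_L_drawing G x y \<and>
     (\<forall>e \<in> parcs G. mono_on {0..1} (fst \<circ> L_edge x y e) \<and> mono_on {0..1} (snd \<circ> L_edge x y e))"

end

theory Submission
  imports Defs
begin

text \<open>
  From an L-drawing to a pair: take \<open>\<pi> = y\<close> and tilt the segments slightly so that overlaps become
  disjoint. Around a vertex, the edges turning left then come first, ordered by increasing height
  of their heads, followed by those turning right, ordered by decreasing height.

  From a pair to an L-drawing: take \<open>y = \<pi>\<close>. A horizontal line sweeping over the upward drawing
  replaces at each vertex a block of consecutive incoming edges by the outgoing ones. As only the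
  first vertex is a source and only the last one a sink, two incomparable vertices that are
  adjacent in the sweep have disjoint blocks, so they can be exchanged, and hence the sweep may
  follow \<open>\<pi>\<close>. The columns are then chosen in the order of \<open>\<pi>\<close>, keeping the cut edges sorted by
  the columns of their tails.
\<close>

section \<open>Bitonic lists\<close>

text \<open>The heights in the given upward drawing need not follow \<open>\<pi>\<close>, and
  deforming the drawing until they do would be a topological argument. Cut lists avoid it: once the
  drawing is read off as a sequence of list replacements, reordering vertices means commuting
  replacements. The geometric input is that the left-to-right order of two edges cannot change
  between their ends. The columns of the tails matter because, at the height of a new vertex
  \<open>v\<close>, a pending edge of an L-drawing is still on its vertical segment, in the column
  of its tail. So \<open>v\<close> must reach its predecessors along a horizontal line that crosses
  no such column. The incoming edges being consecutive in the cut, the only obstacle is the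
  predecessor \<open>u\<close> beside which \<open>v\<close> is placed: further pending edges of
  \<open>u\<close> share its column, which \<open>v\<close> cannot use. Such edges on both sides of
  \<open>(u, v)\<close> would force \<open>v\<close> to be both left and right of that column if the
  cut is to stay sorted. Bitonicity excludes this, since their heads would be higher than
  \<open>v\<close> on either side of it. For decreasing lists no pending edge of \<open>u\<close>
  lies to the right, so every edge can go rightward.\<close>

lemma mono_decreasing_imp_bitonic:
  "mono_decreasing \<pi> vs \<Longrightarrow> bitonic \<pi> vs"
  unfolding mono_decreasing_def bitonic_def by auto

lemma mono_decreasing_iff_sorted_wrt:
  "mono_decreasing \<pi> vs \<longleftrightarrow> sorted_wrt (\<lambda>a b. \<pi> a > \<pi> b) vs"
proof -
  have "transp (\<lambda>a b. \<pi> a > \<pi> b)"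
    by (auto intro: transpI)
  then show ?thesis
    unfolding mono_decreasing_def by (subst sorted_wrt_iff_nth_Suc_transp) auto
qed

text \<open>The larger of \<open>last us\<close> and \<open>hd vs\<close> is the peak, so one run
  absorbs the end of the other; the case split decides whether the peak is the last position of
  \<open>us\<close> or the first of \<open>vs\<close>.\<close>

lemma bitonic_appendI:
  assumes "sorted_wrt (\<lambda>a b. \<pi> a < \<pi> b) us" "sorted_wrt (\<lambda>a b. \<pi> a > \<pi> b) vs"
    and ne: "us \<noteq> [] \<Longrightarrow> vs \<noteq> [] \<Longrightarrow> \<pi> (last us) \<noteq> \<pi> (hd vs)"
  shows "bitonic \<pi> (us @ vs)"
proof (cases "us \<noteq> [] \<and> vs \<noteq> [] \<and> \<pi> (last us) > \<pi> (hd vs)")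
  case True
  then obtain bs l where us: "us = bs @ [l]" by (metis rev_exhaust)
  then have sorted: "sorted_wrt (\<lambda>a b. \<pi> a > \<pi> b) (l # vs)"
    using True assms(2) by (cases vs) auto
  have "\<pi> ((us @ vs) ! i) < \<pi> ((us @ vs) ! Suc i)" if "Suc i < length us" for i
    using sorted_wrt_nth_less[OF assms(1), of i "Suc i"] that by (simp add: nth_append)
  moreover have "\<pi> ((us @ vs) ! i) > \<pi> ((us @ vs) ! Suc i)"
    if i: "length bs \<le> i" "Suc i < length (us @ vs)" for i
  proof -
    obtain j where j: "i = length bs + j" using le_Suc_ex[OF i(1)] by auto
    have "us @ vs = bs @ (l # vs)" using us by simp
    moreover have "(bs @ (l # vs)) ! i = (l # vs) ! j" "(bs @ (l # vs)) ! Suc i = (l # vs) ! Suc j"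
      unfolding j by (simp_all add: nth_append)
    ultimately show ?thesis
      using sorted_wrt_nth_less[OF sorted, of j "Suc j"] i(2) j us by simp
  qed
  ultimately show ?thesis
    unfolding bitonic_def using us by (intro exI[of _ "length bs"]) auto
next
  case False
  have "\<pi> ((us @ vs) ! i) < \<pi> ((us @ vs) ! Suc i)"
    if "i < length us" "Suc i < length (us @ vs)" for i
  proof (cases "Suc i < length us")
    case True
    then show ?thesis
      using sorted_wrt_nth_less[OF assms(1), of i "Suc i"] by (simp add: nth_append)
  next
    case F: False
    then have "i = length us - 1" "us \<noteq> []" "vs \<noteq> []"
      using that by auto
    then have "(us @ vs) ! i = last us" "(us @ vs) ! Suc i = hd vs"
      by (simp_all add: nth_append last_conv_nth hd_conv_nth)
    with \<open>us \<noteq> []\<close> \<open>vs \<noteq> []\<close> show ?thesis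
      using False ne by force
  qed
  moreover have "\<pi> ((us @ vs) ! i) > \<pi> ((us @ vs) ! Suc i)"
    if "length us \<le> i" "Suc i < length (us @ vs)" for i
    using sorted_wrt_nth_less[OF assms(2), of "i - length us" "Suc (i - length us)"] that
    by (simp add: nth_append Suc_diff_le)
  ultimately show ?thesis
    unfolding bitonic_def by (intro exI[of _ "length us"]) auto
qed

text \<open>Some value before \<open>v\<close> exceeds that of \<open>v\<close>, so the peak lies
  before \<open>v\<close> and everything after \<open>v\<close> descends.\<close>

lemma bitonic_no_valley:
  assumes "bitonic \<pi> (xs @ [v] @ ys)" "a \<in> set xs" "b \<in> set ys" "\<pi> v < \<pi> a"
  shows "\<pi> b < \<pi> v"
proof -
  let ?l = "xs @ [v] @ ys"
  obtain h where up: "\<And>i. Suc i < length ?l \<Longrightarrow> i < h \<Longrightarrow> \<pi> (?l ! i) < \<pi> (?l ! Suc i)"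
    and down: "\<And>i. Suc i < length ?l \<Longrightarrow> h \<le> i \<Longrightarrow> \<pi> (?l ! i) > \<pi> (?l ! Suc i)"
    using assms(1) unfolding bitonic_def by blast
  have up': "\<pi> (?l ! i) \<le> \<pi> (?l ! j)" if "i \<le> j" "j \<le> h" "j < length ?l" for i j
    using that
  proof (induction rule: dec_induct)
    case (step n)
    then show ?case using up[of n] by force
  qed simp
  have down': "\<pi> (?l ! i) \<ge> \<pi> (?l ! j)" if "i \<le> j" "h \<le> i" "j < length ?l" for i j
    using that
  proof (induction rule: dec_induct)
    case (step n)
    then show ?case using down[of n] by force
  qed simp
  obtain i where i: "i < length xs" "?l ! i = a"
    using assms(2) by (auto simp: in_set_conv_nth nth_append)
  obtain j where j: "j < length ys" "?l ! (Suc (length xs) + j) = b"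
    using assms(3) by (auto simp: in_set_conv_nth nth_append)
  have v: "?l ! length xs = v" by (simp add: nth_append)
  have "h < length xs"
    using up'[of i "length xs"] i v assms(4) by force
  then have "\<pi> v > \<pi> (?l ! Suc (length xs))"
    using down[of "length xs"] v j(1) by (cases ys) auto
  moreover have "\<pi> (?l ! Suc (length xs)) \<ge> \<pi> b"
    using down'[of "Suc (length xs)" "Suc (length xs) + j"] \<open>h < length xs\<close> j by auto
  ultimately show ?thesis by simp
qed

section \<open>Sorted lists\<close>

text \<open>Carries positions among the pending successors of a vertex, which form a filtered list,
  back to its full list of successors, where bitonicity is stated.\<close>

lemma filter_eq_append_ConsD:
  assumes "filter P xs = us @ v # ws"
  shows "\<exists>us' ws'. xs = us' @ [v] @ ws' \<and> set us \<subseteq> set us' \<and> set ws \<subseteq> set ws'"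
  using assms
proof (induction xs arbitrary: us)
  case (Cons a xs)
  consider "\<not> P a" | "P a" "us = []" | us1 where "P a" "us = a # us1"
    using Cons.prems by (cases us) (auto split: if_splits)
  then show ?case
  proof cases
    case 1
    then obtain us' ws' where "xs = us' @ [v] @ ws'" "set us \<subseteq> set us'" "set ws \<subseteq> set ws'"
      using Cons by (metis filter.simps(2))
    then show ?thesis by (intro exI[of _ "a # us'"] exI[of _ ws']) auto
  next
    case 2
    then show ?thesis using Cons.prems by (intro exI[of _ "[]"] exI[of _ xs]) auto
  next
    case 3
    then obtain us' ws' where "xs = us' @ [v] @ ws'" "set us1 \<subseteq> set us'" "set ws \<subseteq> set ws'"
      using Cons by (metis filter.simps(2) append_Cons list.inject)
    then show ?thesis using 3 by (intro exI[of _ "a # us'"] exI[of _ ws']) auto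
  qed
qed simp

text \<open>Applied with \<open>c\<close> the x-coordinate of a vertex, to split a cut into the
  edges passing left of it, through it and right of it, and with \<open>c = 0\<close>, to split
  slopes by sign.\<close>

lemma sorted_map_split:
  fixes k :: "'b \<Rightarrow> 'c::linorder"
  assumes "sorted (map k xs)"
  shows "filter (\<lambda>x. k x < c) xs @ filter (\<lambda>x. k x = c) xs @ filter (\<lambda>x. c < k x) xs = xs"
  using assms
proof (induction xs)
  case (Cons a xs)
  then have IH: "filter (\<lambda>x. k x < c) xs @ filter (\<lambda>x. k x = c) xs @ filter (\<lambda>x. c < k x) xs = xs"
    and le: "\<forall>x\<in>set xs. k a \<le> k x" by auto
  consider "k a < c" | "k a = c" | "c < k a" by fastforce
  then show ?case
  proof cases
    case 1
    with IH show ?thesis by auto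
  next
    case 2
    with le have "filter (\<lambda>x. k x < c) xs = []" by (auto simp: filter_empty_conv)
    with 2 IH show ?thesis by simp
  next
    case 3
    with le have "filter (\<lambda>x. k x < c) xs = []" "filter (\<lambda>x. k x = c) xs = []"
      by (auto simp: filter_empty_conv)
    with 3 IH show ?thesis by auto
  qed
qed simp

text \<open>\<open>sorted_wrt\<close> relates all pairs, so two different heads would have to
  precede each other. Asymmetry is the right assumption because the relation used is
  \<open>left\<close>, which compares only edges with a common height.\<close>

lemma sorted_wrt_unique:
  assumes "sorted_wrt R xs" "sorted_wrt R ys" "set xs = set ys" "distinct xs" "distinct ys"
    and asym: "\<And>a b. a \<in> set xs \<Longrightarrow> b \<in> set xs \<Longrightarrow> a \<noteq> b \<Longrightarrow> R a b \<Longrightarrow> \<not> R b a"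
  shows "xs = ys"
  using assms
proof (induction xs arbitrary: ys)
  case (Cons a xs)
  obtain b ys' where ys: "ys = b # ys'"
    using Cons.prems(3) by (cases ys) auto
  have "a = b"
  proof (rule ccontr)
    assume "a \<noteq> b"
    then have "a \<in> set ys'" "b \<in> set xs" using Cons.prems(3) ys by auto
    then have "R a b" "R b a" using Cons.prems(1,2) ys by auto
    with Cons.prems(6)[of a b] \<open>b \<in> set xs\<close> \<open>a \<noteq> b\<close> show False by simp
  qed
  moreover have "xs = ys'"
  proof (rule Cons.IH)
    show "set xs = set ys'"
      using Cons.prems(3,4,5) ys \<open>a = b\<close> by auto
    show "\<not> R d c" if "c \<in> set xs" "d \<in> set xs" "c \<noteq> d" "R c d" for c d
      using Cons.prems(6)[of c d] that by simp
  qed (use Cons.prems(1,2,4,5) ys in simp_all)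
  ultimately show ?case using ys by simp
qed simp

lemma obtain_sorted_list:
  fixes k :: "'b \<Rightarrow> 'c::linorder"
  assumes "finite A" "inj_on k A"
  obtains xs where "distinct xs" "set xs = A" "sorted_wrt (\<lambda>a b. k a < k b) xs"
proof
  let ?xs = "map (inv_into A k) (sorted_list_of_set (k ` A))"
  show "distinct ?xs"
    using assms by (auto simp: distinct_map intro: inj_on_inv_into)
  show "set ?xs = A"
    using assms by (force simp: image_image)
  show "sorted_wrt (\<lambda>a b. k a < k b) ?xs"
    unfolding sorted_wrt_map
    by (rule sorted_wrt_mono_rel[OF _ strict_sorted_list_of_set])
      (use assms in \<open>auto simp: f_inv_into_f inv_into_f_f\<close>)
qed

section \<open>Sweeping over an embedding\<close>

text \<open>\<open>L\<close> lists, from left to right, the edges cut by a sweep line that has yet to pass \<open>vs\<close>.\<close>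

fun sweep :: "('a \<Rightarrow> 'e list) \<Rightarrow> ('a \<Rightarrow> 'e list) \<Rightarrow> 'e list \<Rightarrow> 'a list \<Rightarrow> bool" where
  "sweep I O' L [] \<longleftrightarrow> True"
| "sweep I O' L (v # vs) \<longleftrightarrow> (\<exists>A B. L = A @ I v @ B \<and> sweep I O' (A @ O' v @ B) vs)"

text \<open>Overlapping occurrences would share an element. Nonemptiness matters: an empty block may
  sit strictly inside the other one.\<close>

lemma append_eq_append_disjoint_blocks:
  assumes eq: "A @ xs @ B = C @ ys @ D"
    and disj: "set xs \<inter> set ys = {}" and ne: "xs \<noteq> []" "ys \<noteq> []"
  obtains M where "A = C @ ys @ M" "D = M @ xs @ B"
        | M where "C = A @ xs @ M" "B = M @ ys @ D"
proof -
  have *: "\<exists>ws. (as = cs @ ws \<and> ws @ bs = ds) \<or> (as @ ws = cs \<and> bs = ws @ ds)"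
    if "as @ bs = cs @ ds" for as bs cs ds :: "'a list"
    using that by (simp only: append_eq_append_conv2)
  from *[OF eq] obtain us
    where "A = C @ us \<and> us @ xs @ B = ys @ D \<or> A @ us = C \<and> xs @ B = us @ ys @ D" by blast
  then show thesis
  proof (elim disjE conjE)
    assume A: "A = C @ us" "us @ xs @ B = ys @ D"
    from *[OF A(2)] obtain vs
      where "us = ys @ vs \<and> vs @ xs @ B = D \<or> us @ vs = ys \<and> xs @ B = vs @ D" by blast
    then show thesis
    proof (elim disjE conjE)
      assume "us @ vs = ys" "xs @ B = vs @ D"
      moreover from this have "vs = []"
        using disj ne by (cases vs; cases xs) auto
      ultimately show thesis using A(1) that(1)[of "[]"] by simp
    qed (use A(1) that(1)[of vs] in simp)
  next
    assume A: "A @ us = C" "xs @ B = us @ ys @ D"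
    from *[OF A(2)] obtain vs
      where "xs = us @ vs \<and> vs @ B = ys @ D \<or> xs @ vs = us \<and> B = vs @ ys @ D" by blast
    then show thesis
    proof (elim disjE conjE)
      assume "xs = us @ vs" "vs @ B = ys @ D"
      moreover from this have "vs = []"
        using disj ne by (cases vs; cases ys) auto
      ultimately show thesis using A(1) that(2)[of "[]"] by simp
    qed (use A(1) that(2)[of vs] in simp)
  qed
qed

text \<open>No edge runs from \<open>a\<close> to \<open>b\<close>, so the block \<open>I b\<close>
  lies entirely left or right of \<open>O' a\<close> and was already present in \<open>L\<close>.
  The two replacements act at different places and commute.\<close>

lemma sweep_swap:
  assumes "sweep I O' L (a # b # vs)" "set (O' a) \<inter> set (I b) = {}" "O' a \<noteq> []" "I b \<noteq> []"
  shows "sweep I O' L (b # a # vs)"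
proof -
  obtain A B C D where 1: "L = A @ I a @ B" "A @ O' a @ B = C @ I b @ D"
    "sweep I O' (C @ O' b @ D) vs"
    using assms(1) by auto
  from append_eq_append_disjoint_blocks[OF 1(2) assms(2-4)] show ?thesis
  proof cases
    case (1 M)
    have "L = C @ I b @ (M @ I a @ B)" "C @ O' b @ (M @ I a @ B) = (C @ O' b @ M) @ I a @ B"
      "sweep I O' ((C @ O' b @ M) @ O' a @ B) vs"
      using 1 \<open>L = _\<close> \<open>sweep I O' (C @ O' b @ D) vs\<close> by simp_all
    then show ?thesis unfolding sweep.simps by blast
  next
    case (2 M)
    have "L = (A @ I a @ M) @ I b @ D" "(A @ I a @ M) @ O' b @ D = A @ I a @ (M @ O' b @ D)"
      "sweep I O' (A @ O' a @ (M @ O' b @ D)) vs"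
      using 2 \<open>L = _\<close> \<open>sweep I O' (C @ O' b @ D) vs\<close> by simp_all
    then show ?thesis unfolding sweep.simps by blast
  qed
qed

lemma sweep_move_to_front:
  assumes "sweep I O' L (us @ w # vs)"
    and "\<forall>u\<in>set us. set (O' u) \<inter> set (I w) = {} \<and> O' u \<noteq> [] \<and> I w \<noteq> []"
  shows "sweep I O' L (w # us @ vs)"
  using assms
proof (induction us arbitrary: L)
  case (Cons u us)
  then obtain A B where "L = A @ I u @ B" "sweep I O' (A @ O' u @ B) (us @ w # vs)" by auto
  moreover from this(2) have "sweep I O' (A @ O' u @ B) (w # us @ vs)"
    by (rule Cons.IH) (use Cons.prems(2) in simp)
  ultimately have "sweep I O' L (u # w # us @ vs)"
    unfolding sweep.simps(2)[of I O' L u] by blast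
  with Cons.prems(2) show ?case by (simp del: sweep.simps add: sweep_swap)
qed simp

text \<open>Adjacent transpositions lead from one topological ordering to any other. The nonemptiness
  condition on \<open>vs\<close> says that only the first vertex may be a source and only the last one
  a sink: without it, the incoming edges of a vertex could be nested around the place where
  a sink vanished.\<close>

lemma sweep_reorder:
  assumes "sweep I O' L vs" "distinct vs" "distinct ws" "set ws = set vs"
    and "sorted_wrt (\<lambda>a b. O' a \<noteq> [] \<and> I b \<noteq> []) vs"
    and "sorted_wrt (\<lambda>a b. set (O' b) \<inter> set (I a) = {}) ws"
  shows "sweep I O' L ws"
  using assms
proof (induction ws arbitrary: L vs)
  case (Cons w ws)
  then obtain us zs where vs: "vs = us @ w # zs"
    by (metis list.set_intros(1) split_list)
  \<comment> \<open>The vertices \<open>us\<close> that precede \<open>w\<close> in the old order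
    follow it in the new one, so none of their outgoing edges enters \<open>w\<close>.\<close>
  have "set us \<subseteq> set ws" using Cons.prems(2,3,4) vs by auto
  then have "sweep I O' L (w # us @ zs)"
    using Cons.prems(1,5,6) unfolding vs
    by (intro sweep_move_to_front) (auto simp: sorted_wrt_append)
  then obtain A B where "L = A @ I w @ B" "sweep I O' (A @ O' w @ B) (us @ zs)" by auto
  moreover from this(2) have "sweep I O' (A @ O' w @ B) ws"
    using Cons.prems(2-6) vs by (intro Cons.IH[of _ "us @ zs"]) (auto simp: sorted_wrt_append)
  ultimately show ?case by auto
qed simp

section \<open>Choosing the columns\<close>

text \<open>\<open>blocks x y e f\<close> holds when the vertical segment of \<open>e\<close> crosses the horizontal segment
  of \<open>f\<close>.\<close>

definition blocks ::
  "('a \<Rightarrow> 'b::linorder) \<Rightarrow> ('a \<Rightarrow> 'c::linorder) \<Rightarrow> 'a \<times> 'a \<Rightarrow> 'a \<times> 'a \<Rightarrow> bool" where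
  "blocks x y e f \<longleftrightarrow> y (fst e) < y (snd f) \<and> y (snd f) < y (snd e) \<and>
     (x (fst f) < x (fst e) \<and> x (fst e) < x (snd f) \<or>
      x (snd f) < x (fst e) \<and> x (fst e) < x (fst f))"

text \<open>Columns are first chosen as reals, so that a new one always fits directly beside an
  existing one; ranks turn them into integers at the end.\<close>

lemma finite_gap_above:
  fixes a :: real
  assumes "finite S"
  shows "\<exists>c>a. \<forall>s\<in>S. a < s \<longrightarrow> c < s"
  using assms
proof induction
  case empty
  show ?case by (auto intro: gt_ex)
next
  case (insert s S)
  then obtain c where c: "c > a" "\<forall>s\<in>S. a < s \<longrightarrow> c < s" by auto
  show ?case
  proof (cases "a < s")
    case True
    with c have "min c ((a + s) / 2) > a" "min c ((a + s) / 2) < s" by (auto simp: min_def)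
    with c show ?thesis by (intro exI[of _ "min c ((a + s) / 2)"]) auto
  qed (use c in auto)
qed

lemma finite_gap_below:
  fixes a :: real
  assumes "finite S"
  shows "\<exists>c<a. \<forall>s\<in>S. s < a \<longrightarrow> s < c"
proof -
  obtain c where "c > - a" "\<forall>s\<in>uminus ` S. - a < s \<longrightarrow> c < s"
    using finite_gap_above[of "uminus ` S" "- a"] assms by auto
  then show ?thesis by (intro exI[of _ "- c"]) force
qed

text \<open>Each new vertex goes directly to the right of its rightmost predecessor \<open>u\<close>, or directly
  to the left of it if \<open>u\<close> still has pending edges to the right of the current one. In the latter
  case \<open>u\<close> has no pending edges to the left, because its list of successors has no valley, so
  either choice keeps the pending edges sorted by their columns.\<close>

lemma sweep_imp_columns:
  fixes x :: "'a \<Rightarrow> real" and \<pi> :: "'a \<Rightarrow> int"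
  assumes "sweep (\<lambda>v. map (\<lambda>u. (u, v)) (pr v)) (\<lambda>v. map (Pair v) (su v)) L ws"
    and "finite P" "distinct ws" "P \<inter> set ws = {}" "V = P \<union> set ws"
    and E: "E \<subseteq> V \<times> V" "\<forall>(u, v)\<in>E. \<pi> u < \<pi> v"
    and su: "\<forall>v\<in>V. distinct (su v) \<and> set (su v) = {w. (v, w) \<in> E} \<and> bitonic \<pi> (su v)"
    and pr: "\<forall>v\<in>V. distinct (pr v) \<and> set (pr v) = {u. (u, v) \<in> E}"
    and "\<forall>v\<in>set ws. pr v \<noteq> []"
    and "sorted_wrt (\<lambda>a b. \<pi> a < \<pi> b) ws" "\<forall>p\<in>P. \<forall>w\<in>set ws. \<pi> p < \<pi> w"
    and "inj_on x P" "sorted (map (x \<circ> fst) L)" "fst ` set L \<subseteq> P"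
    and "\<forall>u\<in>P. filter (\<lambda>e. fst e = u) L = map (Pair u) (filter (\<lambda>w. w \<notin> P) (su u))"
  shows "\<exists>x'. (\<forall>p\<in>P. x' p = x p) \<and> inj_on x' V \<and>
      (\<forall>e\<in>E. \<forall>f\<in>E. snd f \<in> set ws \<longrightarrow> \<not> blocks x' \<pi> e f) \<and>
      ((\<forall>v\<in>V. mono_decreasing \<pi> (su v)) \<longrightarrow> (\<forall>(u, v)\<in>E. v \<in> set ws \<longrightarrow> x' u < x' v))"
  using assms(1-5,10-)
proof (induction ws arbitrary: L P x)
  case Nil
  then show ?case by (intro exI[of _ x]) auto
next
  case (Cons v ws)
  note sweep = Cons.prems(1) and finP = Cons.prems(2) and dist = Cons.prems(3)
    and disj = Cons.prems(4) and V = Cons.prems(5) and ne = Cons.prems(6)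
    and sortws = Cons.prems(7) and less = Cons.prems(8) and inj = Cons.prems(9)
    and sortL = Cons.prems(10) and tails = Cons.prems(11) and filt = Cons.prems(12)
  let ?I = "\<lambda>v. map (\<lambda>u. (u, v)) (pr v)" and ?O = "\<lambda>v. map (Pair v) (su v)"
  from sweep obtain A B where L: "L = A @ ?I v @ B" and sweep': "sweep ?I ?O (A @ ?O v @ B) ws"
    by auto
  have v: "v \<in> V" "v \<notin> P" "v \<notin> set ws" using V disj dist by auto
  \<comment> \<open>Vertices are placed in increasing order of \<open>\<pi>\<close>, so comparing
    with \<open>\<pi> v\<close> tells which ones are already placed.\<close>
  have P_iff: "p \<in> P \<longleftrightarrow> \<pi> p < \<pi> v" if "p \<in> V" for p
    using that V less sortws by force
  have ws_iff: "p \<in> set ws \<longleftrightarrow> \<pi> v < \<pi> p" if "p \<in> V" for p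
    using that V less sortws by force
  have in_L: "(a, b) \<in> set L \<longleftrightarrow> a \<in> P \<and> (a, b) \<in> E \<and> b \<notin> P" for a b
  proof (cases "a \<in> P")
    case True
    then have "(a, b) \<in> set L \<longleftrightarrow> (a, b) \<in> set (filter (\<lambda>e. fst e = a) L)" by auto
    then show ?thesis using True filt su V by auto
  qed (use tails in force)
  have pr_v: "distinct (pr v)" "\<And>w. w \<in> set (pr v) \<longleftrightarrow> (w, v) \<in> E" using pr v by auto
  have pr_P: "w \<in> P" if "w \<in> set (pr v)" for w
    using that P_iff[of w] pr_v E by fastforce
  \<comment> \<open>All edges into \<open>v\<close> are in the block \<open>?I v\<close>; a further
    copy in \<open>A\<close> or \<open>B\<close> would make the list of pending edges of its tail
    repeat an entry.\<close>
  have notv: "b \<noteq> v" if "(a, b) \<in> set A \<union> set B" for a b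
  proof
    assume "b = v"
    have "(a, b) \<in> set L" using that L by auto
    then have "a \<in> P" "(a, v) \<in> set (?I v)" using in_L \<open>b = v\<close> pr_v by auto
    then have "distinct (filter (\<lambda>e. fst e = a) L)"
      using filt su V by (auto simp: distinct_map inj_on_def)
    then show False using that \<open>b = v\<close> \<open>(a, v) \<in> set (?I v)\<close> unfolding L by auto
  qed
  define u where "u = last (pr v)"
  obtain us where us: "pr v = us @ [u]"
    using ne unfolding u_def by (metis append_butlast_last_id list.set_intros(1))
  have u: "u \<in> set (pr v)" "u \<in> P" using us pr_P by auto
  have "filter (\<lambda>e. fst e = u) (?I v) = [(u, v)]"
    using us pr_v(1) by (auto simp: filter_empty_conv)
  then have "map (Pair u) (filter (\<lambda>w. w \<notin> P) (su u)) =
      filter (\<lambda>e. fst e = u) A @ (u, v) # filter (\<lambda>e. fst e = u) B"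
    using filt u L by force
  then have "map snd (map (Pair u) (filter (\<lambda>w. w \<notin> P) (su u))) =
      map snd (filter (\<lambda>e. fst e = u) A) @ v # map snd (filter (\<lambda>e. fst e = u) B)" by simp
  then have "filter (\<lambda>w. w \<notin> P) (su u) =
      map snd (filter (\<lambda>e. fst e = u) A) @ v # map snd (filter (\<lambda>e. fst e = u) B)"
    by (simp add: comp_def)
  from filter_eq_append_ConsD[OF this] obtain ls rs where su_u: "su u = ls @ [v] @ rs"
    and sub: "set (map snd (filter (\<lambda>e. fst e = u) A)) \<subseteq> set ls"
      "set (map snd (filter (\<lambda>e. fst e = u) B)) \<subseteq> set rs"
    by blast
  have ls: "a \<in> set ls" if "(u, a) \<in> set A" for a
    using sub(1) that by force
  have rs: "b \<in> set rs" if "(u, b) \<in> set B" for b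
    using sub(2) that by force
  have later: "\<pi> v < \<pi> b" if "(a, b) \<in> set A \<union> set B" for a b
  proof -
    have "b \<in> V" "b \<notin> P" "b \<noteq> v" using that L in_L[of a b] notv E by auto
    then show ?thesis using V ws_iff by auto
  qed
  \<comment> \<open>In a decreasing list the successors of \<open>u\<close> to the right of
    \<open>v\<close> are lower than \<open>v\<close>, so their edges have left the cut. Hence
    \<open>v\<close> can go to the right of all its predecessors.\<close>
  have right: "u \<notin> fst ` set B" if "mono_decreasing \<pi> (su u)"
  proof
    assume "u \<in> fst ` set B"
    then obtain b where b: "(u, b) \<in> set B" by auto
    have "\<pi> b < \<pi> v"
      using that rs[OF b] unfolding mono_decreasing_iff_sorted_wrt su_u
      by (simp add: sorted_wrt_append)
    then show False using later[of u b] b by simp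
  qed
  have "bitonic \<pi> (su u)" using su u V by auto
  \<comment> \<open>Pending edges of \<open>u\<close> on both sides would have heads above
    \<open>v\<close>, making \<open>v\<close> a valley among the successors of
    \<open>u\<close>.\<close>
  then have one_side: "u \<notin> fst ` set A \<or> u \<notin> fst ` set B"
  proof (rule contrapos_pp)
    assume "\<not> (u \<notin> fst ` set A \<or> u \<notin> fst ` set B)"
    then obtain a b where ab: "(u, a) \<in> set A" "(u, b) \<in> set B" by auto
    then have "\<pi> v < \<pi> a" "\<pi> v < \<pi> b" using later by auto
    then show "\<not> bitonic \<pi> (su u)"
      using bitonic_no_valley[of \<pi> ls v rs a b] ls rs ab unfolding su_u by auto
  qed
  have order: "x a \<le> x w" if "a \<in> fst ` set A" "w \<in> set (pr v)" for a w
    using sortL that unfolding L by (force simp: sorted_append)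
  have order': "x w \<le> x b" if "b \<in> fst ` set B" "w \<in> set (pr v)" for b w
    using sortL that unfolding L by (force simp: sorted_append)
  have order_pr: "x w \<le> x u" if "w \<in> set (pr v)" for w
    using sortL that unfolding L us by (force simp: sorted_append)
  have tailsP: "a \<in> P" if "a \<in> fst ` set A \<union> fst ` set B" for a
    using tails that L by auto
  have "\<exists>c. c \<notin> x ` P \<and> (\<forall>a\<in>fst ` set A. x a < c) \<and> (\<forall>b\<in>fst ` set B. c < x b) \<and>
      (u \<notin> fst ` set B \<longrightarrow> (\<forall>w\<in>set (pr v). x w < c))"
  proof (cases "u \<in> fst ` set B")
    case False
    obtain c where c: "c > x u" "\<forall>s\<in>x ` P. x u < s \<longrightarrow> c < s"
      using finite_gap_above[of "x ` P" "x u"] finP by auto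
    \<comment> \<open>Tails in \<open>B\<close> differ from \<open>u\<close> here, so by injectivity
      their columns are not \<open>x u\<close> and lie beyond the gap.\<close>
    have "c < x b" if "b \<in> fst ` set B" for b
    proof -
      have "x u \<noteq> x b" "b \<in> P"
        using inj_onD[OF inj, of u b] False that tailsP u by auto
      then show ?thesis using c(2) order'[OF that u(1)] by auto
    qed
    moreover have "c \<notin> x ` P" using c by auto
    moreover have "x a < c" if "a \<in> fst ` set A" for a
      using order[OF that u(1)] c(1) by simp
    moreover have "x w < c" if "w \<in> set (pr v)" for w
      using order_pr[OF that] c(1) by simp
    ultimately show ?thesis by blast
  next
    case True
    with one_side have F: "u \<notin> fst ` set A" by simp
    obtain c where c: "c < x u" "\<forall>s\<in>x ` P. s < x u \<longrightarrow> s < c"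
      using finite_gap_below[of "x ` P" "x u"] finP by auto
    have "x a < c" if "a \<in> fst ` set A" for a
    proof -
      have "x u \<noteq> x a" "a \<in> P"
        using inj_onD[OF inj, of u a] F that tailsP u by auto
      then show ?thesis using c(2) order[OF that u(1)] by auto
    qed
    moreover have "c \<notin> x ` P" using c by auto
    moreover have "c < x b" if "b \<in> fst ` set B" for b
      using order'[OF that u(1)] c(1) by simp
    ultimately show ?thesis using True by blast
  qed
  then obtain c where c: "c \<notin> x ` P"
    and cA: "\<forall>a\<in>fst ` set A. x a < c" and cB: "\<forall>b\<in>fst ` set B. c < x b"
    and c_pr: "u \<notin> fst ` set B \<longrightarrow> (\<forall>w\<in>set (pr v). x w < c)"
    by (elim exE conjE) (rule that)
  define x1 where "x1 = x(v := c)"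
  have x1: "x1 v = c" "\<And>p. p \<in> P \<Longrightarrow> x1 p = x p" using v by (auto simp: x1_def)
  have "\<exists>x'. (\<forall>p\<in>insert v P. x' p = x1 p) \<and> inj_on x' V \<and>
      (\<forall>e\<in>E. \<forall>f\<in>E. snd f \<in> set ws \<longrightarrow> \<not> blocks x' \<pi> e f) \<and>
      ((\<forall>v\<in>V. mono_decreasing \<pi> (su v)) \<longrightarrow> (\<forall>(u, v)\<in>E. v \<in> set ws \<longrightarrow> x' u < x' v))"
  proof (rule Cons.IH[OF sweep'])
    show "inj_on x1 (insert v P)"
      using inj c v by (auto simp: x1_def inj_on_def)
    have mapx: "map (x1 \<circ> fst) A = map (x \<circ> fst) A" "map (x1 \<circ> fst) B = map (x \<circ> fst) B"
      using tailsP x1(2) by auto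
    have "sorted (map (x1 \<circ> fst) (?O v))"
      by (simp add: sorted_wrt_iff_nth_less)
    moreover have "sorted (map (x \<circ> fst) A)" "sorted (map (x \<circ> fst) B)"
      "\<forall>a\<in>set A. \<forall>b\<in>set B. x (fst a) \<le> x (fst b)"
      using sortL unfolding L by (auto simp: sorted_append comp_def)
    ultimately show "sorted (map (x1 \<circ> fst) (A @ ?O v @ B))"
      using cA cB x1(1) less_imp_le unfolding map_append mapx
      by (auto simp: sorted_append less_imp_le)
    show "fst ` set (A @ ?O v @ B) \<subseteq> insert v P" using tailsP by auto
    show "\<forall>p\<in>insert v P. \<forall>w\<in>set ws. \<pi> p < \<pi> w" using less sortws by auto
    show "\<forall>u\<in>insert v P. filter (\<lambda>e. fst e = u) (A @ ?O v @ B) =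
        map (Pair u) (filter (\<lambda>w. w \<notin> insert v P) (su u))"
    proof (intro ballI, elim insertE)
      fix a assume "a = v"
      have "\<pi> v < \<pi> w" "w \<in> V" if "w \<in> set (su v)" for w using that su v E by auto
      then have "w \<notin> insert v P" if "w \<in> set (su v)" for w using that P_iff by force
      moreover have "filter (\<lambda>e. fst e = v) A = []" "filter (\<lambda>e. fst e = v) B = []"
        using tailsP v by (auto simp: filter_empty_conv)
      ultimately show "filter (\<lambda>e. fst e = a) (A @ ?O v @ B) =
          map (Pair a) (filter (\<lambda>w. w \<notin> insert v P) (su a))"
        using \<open>a = v\<close> by (simp add: filter_map comp_def filter_id_conv)
    next
      fix a assume "a \<in> P"
      then have "a \<noteq> v" using v by auto
      \<comment> \<open>Passing \<open>v\<close> removes from the cut exactly the edges into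
        \<open>v\<close>, so an older vertex loses at most \<open>v\<close> from its pending
        successors.\<close>
      have "snd e \<noteq> v" if "e \<in> set A \<union> set B" for e
        using notv[of "fst e" "snd e"] that by simp
      then have "filter (\<lambda>e. snd e \<noteq> v) A = A" "filter (\<lambda>e. snd e \<noteq> v) B = B"
        by (simp_all add: filter_id_conv)
      then have "filter (\<lambda>e. fst e = a) (A @ ?O v @ B) =
          filter (\<lambda>e. fst e = a) (filter (\<lambda>e. snd e \<noteq> v) L)"
        unfolding L using \<open>a \<noteq> v\<close> by (simp add: filter_map comp_def)
      also have "\<dots> = filter (\<lambda>e. snd e \<noteq> v) (filter (\<lambda>e. fst e = a) L)"
        by (simp add: conj_commute)
      also have "\<dots> = map (Pair a) (filter (\<lambda>w. w \<notin> insert v P) (su a))"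
        using filt \<open>a \<in> P\<close> by (simp add: filter_map comp_def conj_commute)
      finally show "filter (\<lambda>e. fst e = a) (A @ ?O v @ B) =
          map (Pair a) (filter (\<lambda>w. w \<notin> insert v P) (su a))" .
    qed
  qed (use finP dist disj V ne sortws v in auto)
  then obtain x' where x': "\<forall>p\<in>insert v P. x' p = x1 p" "inj_on x' V"
    and free: "\<forall>e\<in>E. \<forall>f\<in>E. snd f \<in> set ws \<longrightarrow> \<not> blocks x' \<pi> e f"
    and rightward: "(\<forall>v\<in>V. mono_decreasing \<pi> (su v)) \<longrightarrow>
      (\<forall>(u, v)\<in>E. v \<in> set ws \<longrightarrow> x' u < x' v)"
    by (elim exE conjE) (rule that)
  have x'_eq: "x' v = c" "\<And>p. p \<in> P \<Longrightarrow> x' p = x p" using x' x1 by auto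
  \<comment> \<open>An edge whose vertical segment passes the height of \<open>v\<close> is pending
    and does not enter \<open>v\<close>, so it lies in \<open>A\<close> or \<open>B\<close>. Its
    column is then on the same side of \<open>c\<close> and, weakly, of every predecessor of
    \<open>v\<close>, hence not strictly between them.\<close>
  have "\<not> blocks x' \<pi> e f" if ef: "e \<in> E" "f \<in> E" "snd f = v" for e f
  proof
    assume blocks: "blocks x' \<pi> e f"
    obtain a b w where [simp]: "e = (a, b)" "f = (w, v)" using ef(3) by (cases e; cases f) auto
    have ab: "\<pi> a < \<pi> v" "\<pi> v < \<pi> b" using blocks by (auto simp: blocks_def)
    have "a \<in> V" "b \<in> V" using ef E by auto
    then have "(a, b) \<in> set L" "b \<noteq> v" using ab P_iff in_L ef by auto
    then have "(a, b) \<in> set A \<union> set B" unfolding L by auto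
    then have a: "a \<in> fst ` set A \<union> fst ` set B" by force
    have w: "w \<in> set (pr v)" using ef pr_v by auto
    have "x w < x a \<and> x a < c \<or> c < x a \<and> x a < x w"
      using blocks x'_eq tailsP[OF a] pr_P[OF w] by (simp add: blocks_def)
    then show False using a cA cB order[OF _ w] order'[OF _ w] by force
  qed
  moreover have "x' w < x' v" if "\<forall>v\<in>V. mono_decreasing \<pi> (su v)" "(w, v) \<in> E" for w
    using c_pr right that u V pr_v pr_P x'_eq by auto
  ultimately show ?case
    using free rightward x' x'_eq by (intro exI[of _ x']) auto
qed

section \<open>Upward drawings as families of graphs over the vertical axis\<close>

text \<open>In an upward drawing each edge \<open>e\<close> is the graph of a continuous function \<open>F e\<close> giving the
  \<open>x\<close>-coordinate of \<open>e\<close> at each height.\<close>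

locale level_drawing =
  fixes V :: "'a set" and E :: "('a \<times> 'a) set"
    and p :: "'a \<Rightarrow> real \<times> real" and F :: "'a \<times> 'a \<Rightarrow> real \<Rightarrow> real"
  assumes E_sub: "E \<subseteq> V \<times> V"
    and up: "(u, v) \<in> E \<Longrightarrow> snd (p u) < snd (p v)"
    and cont: "(u, v) \<in> E \<Longrightarrow> continuous_on {snd (p u)..snd (p v)} (F (u, v))"
    and ends: "(u, v) \<in> E \<Longrightarrow> F (u, v) (snd (p u)) = fst (p u)"
              "(u, v) \<in> E \<Longrightarrow> F (u, v) (snd (p v)) = fst (p v)"
    and inj: "inj_on p V"
    and avoid: "(u, v) \<in> E \<Longrightarrow> w \<in> V \<Longrightarrow> snd (p w) \<in> {snd (p u)..snd (p v)} \<Longrightarrow>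
      F (u, v) (snd (p w)) = fst (p w) \<Longrightarrow> w = u \<or> w = v"
    and meet: "(u, v) \<in> E \<Longrightarrow> (w, z) \<in> E \<Longrightarrow> (u, v) \<noteq> (w, z) \<Longrightarrow>
      h \<in> {snd (p u)..snd (p v)} \<Longrightarrow> h \<in> {snd (p w)..snd (p z)} \<Longrightarrow>
      F (u, v) h = F (w, z) h \<Longrightarrow> (F (u, v) h, h) \<in> p ` ({u, v} \<inter> {w, z})"
begin

definition heights :: "'a \<times> 'a \<Rightarrow> real set" where
  "heights e = {snd (p (fst e))..snd (p (snd e))}"

definition left :: "'a \<times> 'a \<Rightarrow> 'a \<times> 'a \<Rightarrow> bool" where
  "left e f \<longleftrightarrow> (\<exists>h \<in> heights e \<inter> heights f. F e h < F f h)"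

text \<open>If the order were reversed at \<open>h\<close>, the intermediate value theorem would
  give a meeting point strictly between two heights of \<open>e\<close>. But distinct edges meet
  only at a common end, which lies at an extreme height of \<open>e\<close>. The conclusion is weak
  because of such common ends.\<close>

lemma left_imp_le:
  assumes "left e f" "e \<in> E" "f \<in> E" "h \<in> heights e" "h \<in> heights f"
  shows "F e h \<le> F f h"
proof (rule ccontr)
  assume "\<not> F e h \<le> F f h"
  then have gh: "F f h - F e h < 0" by simp
  obtain h0 where h0: "h0 \<in> heights e" "h0 \<in> heights f" "F f h0 - F e h0 > 0"
    using assms(1) by (auto simp: left_def)
  have sub: "closed_segment h h0 \<subseteq> heights e" "closed_segment h h0 \<subseteq> heights f"
    using assms(4,5) h0(1,2) by (auto simp: heights_def closed_segment_eq_real_ivl)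
  have "continuous_on (heights e) (F e)" "continuous_on (heights f) (F f)"
    using cont[of "fst e" "snd e"] cont[of "fst f" "snd f"] assms(2,3) by (auto simp: heights_def)
  then have c: "continuous_on (closed_segment h h0) (\<lambda>h. F f h - F e h)"
    using sub by (intro continuous_on_diff) (auto intro: continuous_on_subset)
  have "\<exists>k. k \<in> closed_segment h h0 \<and> F f k - F e k = 0"
  proof (cases "h \<le> h0")
    case True
    then show ?thesis
      using IVT'[of "\<lambda>h. F f h - F e h" h 0 h0] c gh h0(3)
      by (auto simp: closed_segment_eq_real_ivl)
  next
    case False
    then show ?thesis
      using IVT2'[of "\<lambda>h. F f h - F e h" h 0 h0] c gh h0(3)
      by (auto simp: closed_segment_eq_real_ivl)
  qed
  then obtain k where k: "k \<in> closed_segment h h0" "F e k = F f k" by auto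
  have "e \<noteq> f" using h0(3) by auto
  then have "(F e k, k) \<in> p ` ({fst e, snd e} \<inter> {fst f, snd f})"
    using meet[of "fst e" "snd e" "fst f" "snd f" k] assms(2,3) k(2) subsetD[OF sub(1) k(1)]
      subsetD[OF sub(2) k(1)] by (auto simp: heights_def)
  then obtain w where "w = fst e \<or> w = snd e" "(F e k, k) = p w" by auto
  then have "k = snd (p (fst e)) \<or> k = snd (p (snd e))" by (metis snd_conv)
  moreover have "k \<noteq> h" "k \<noteq> h0" using k gh h0(3) by auto
  ultimately show False
    using k(1) assms(4) h0(1) by (auto simp: heights_def closed_segment_eq_real_ivl split: if_splits)
qed

lemma left_asym:
  assumes "left e f" "e \<in> E" "f \<in> E"
  shows "\<not> left f e"
proof
  assume "left f e"
  then obtain h where "h \<in> heights e" "h \<in> heights f" "F f h < F e h" by (auto simp: left_def)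
  then show False using left_imp_le[OF assms, of h] by simp
qed

lemma at_vertex_iff:
  assumes "e \<in> E" "v \<in> V" "snd (p v) \<in> heights e"
  shows "F e (snd (p v)) = fst (p v) \<longleftrightarrow> v = fst e \<or> v = snd e"
  using assms avoid[of "fst e" "snd e" v] ends[of "fst e" "snd e"] by (auto simp: heights_def)

text \<open>Vertices at the same height may be swept in any order.\<close>

lemma sweep_by_height:
  assumes su: "\<forall>v\<in>V. distinct (su v) \<and> set (su v) = {w. (v, w) \<in> E} \<and>
      sorted_wrt (\<lambda>w z. left (v, w) (v, z)) (su v)"
    and pr: "\<forall>v\<in>V. distinct (pr v) \<and> set (pr v) = {u. (u, v) \<in> E} \<and>
      sorted_wrt (\<lambda>u w. left (u, v) (w, v)) (pr v)"
    and "distinct vs" "P \<inter> set vs = {}" "V = P \<union> set vs"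
    and "sorted (map (snd \<circ> p) vs)" "\<forall>u\<in>P. \<forall>v\<in>set vs. snd (p u) \<le> snd (p v)"
    and "distinct L" "set L = {(a, b) \<in> E. a \<in> P \<and> b \<notin> P}" "sorted_wrt left L"
  shows "sweep (\<lambda>v. map (\<lambda>u. (u, v)) (pr v)) (\<lambda>v. map (Pair v) (su v)) L vs"
  using assms(3-)
proof (induction vs arbitrary: P L)
  case (Cons v vs)
  note dist = Cons.prems(1) and disj = Cons.prems(2) and V = Cons.prems(3)
    and sorted = Cons.prems(4) and P = Cons.prems(5) and distL = Cons.prems(6)
    and setL = Cons.prems(7) and sortL = Cons.prems(8)
  let ?I = "map (\<lambda>u. (u, v)) (pr v)" and ?O = "map (Pair v) (su v)"
  let ?y = "snd (p v)" and ?x = "fst (p v)"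
  have v: "v \<in> V" "v \<notin> P" using V disj by auto
  have after: "?y \<le> snd (p w)" if "w \<in> V" "w \<notin> P" for w
    using that V sorted by auto
  have before: "snd (p w) \<le> ?y" if "w \<in> P" for w
    using that P by auto
  have y_heights: "?y \<in> heights e" "e \<in> E" if "e \<in> set L" for e
    using that setL E_sub after before by (auto simp: heights_def)
  \<comment> \<open>Height intervals are closed, so even a cut edge whose tail is level with
    \<open>v\<close> has a point at height \<open>?y\<close>, and all cut edges can be compared
    there.\<close>
  have "sorted_wrt (\<lambda>e f. F e ?y \<le> F f ?y) L"
    by (rule sorted_wrt_mono_rel[OF _ sortL]) (use y_heights left_imp_le in auto)
  then have "sorted (map (\<lambda>e. F e ?y) L)"
    by (simp add: sorted_map)
  define A B M where "A = filter (\<lambda>e. F e ?y < ?x) L" and "B = filter (\<lambda>e. ?x < F e ?y) L"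
    and "M = filter (\<lambda>e. F e ?y = ?x) L"
  have L: "L = A @ M @ B"
    using sorted_map_split[OF \<open>sorted (map (\<lambda>e. F e ?y) L)\<close>, of ?x]
    unfolding A_def B_def M_def by simp
  \<comment> \<open>A cut edge through the point of \<open>v\<close> has \<open>v\<close> as an end;
    its tail is in \<open>P\<close>, so \<open>v\<close> is its head.\<close>
  have at_v: "F e ?y = ?x \<longleftrightarrow> snd e = v" if "e \<in> set L" for e
    using at_vertex_iff[OF y_heights(2)[OF that] v(1) y_heights(1)[OF that]] that setL v by auto
  have in_P: "u \<in> P" if "(u, v) \<in> E" for u
    using up[OF that] after[of u] that E_sub by force
  have M: "M = ?I"
  proof (rule sorted_wrt_unique)
    show "sorted_wrt left M" using sortL by (simp add: M_def sorted_wrt_filter)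
    show "sorted_wrt left ?I" using pr v by (simp add: sorted_wrt_map)
    show "distinct M" using distL by (simp add: M_def)
    show "distinct ?I" using pr v by (simp add: distinct_map inj_on_def)
    have "set M = {e \<in> set L. snd e = v}" using at_v by (auto simp: M_def)
    then show "set M = set ?I" using setL pr v in_P by auto
    show "\<not> left b a" if "a \<in> set M" "b \<in> set M" "left a b" for a b
      using left_asym[OF that(3)] that y_heights(2) by (auto simp: M_def)
  qed
  have "set A \<union> set B = {e \<in> set L. F e ?y \<noteq> ?x}"
    by (auto simp: A_def B_def)
  then have AB: "set A \<union> set B = {e \<in> set L. snd e \<noteq> v}"
    using at_v by auto
  have y_O: "e \<in> E \<and> ?y \<in> heights e \<and> F e ?y = ?x" if "e \<in> set ?O" for e
    using that su v up ends(1) by (auto simp: heights_def intro: less_imp_le)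
  have "sweep (\<lambda>v. map (\<lambda>u. (u, v)) (pr v)) (\<lambda>v. map (Pair v) (su v)) (A @ ?O @ B) vs"
  proof (rule Cons.IH[of "insert v P"])
    show "distinct (A @ ?O @ B)"
      using distL setL su v unfolding L by (auto simp: distinct_map inj_on_def)
    have "w \<notin> insert v P" if "(v, w) \<in> E" for w
      using up[OF that] before by force
    moreover have "set ?O = {e \<in> E. fst e = v}" using su v by auto
    moreover have "set (A @ ?O @ B) = set ?O \<union> (set A \<union> set B)" by auto
    ultimately show "set (A @ ?O @ B) = {(a, b) \<in> E. a \<in> insert v P \<and> b \<notin> insert v P}"
      unfolding AB setL using v by auto
    \<comment> \<open>The new edges start at \<open>?x\<close>, while those of \<open>A\<close> are
      strictly left of \<open>?x\<close> at this height; the height of \<open>v\<close> itself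
      witnesses \<open>left\<close>.\<close>
    have "left e f" if "e \<in> set A" "f \<in> set ?O" for e f
      using that y_O[OF that(2)] y_heights(1)[of e] by (auto simp: A_def left_def intro!: bexI[of _ ?y])
    moreover have "left e f" if "e \<in> set ?O" "f \<in> set B" for e f
      using that y_O[OF that(1)] y_heights(1)[of f] by (auto simp: B_def left_def intro!: bexI[of _ ?y])
    moreover have "sorted_wrt left ?O" using su v by (simp add: sorted_wrt_map)
    ultimately show "sorted_wrt left (A @ ?O @ B)"
      using sortL unfolding L by (auto simp: sorted_wrt_append)
  qed (use dist disj V sorted P in auto)
  then show ?case using L M by auto
qed simp

section \<open>Passing between height functions and curves\<close>

definition curve :: "'a \<times> 'a \<Rightarrow> real \<Rightarrow> real \<times> real" where
  "curve e = (\<lambda>h. (F e h, h)) \<circ> linepath (snd (p (fst e))) (snd (p (snd e)))"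

lemma path_image_curve:
  "e \<in> E \<Longrightarrow> path_image (curve e) = (\<lambda>h. (F e h, h)) ` heights e"
  using up[of "fst e" "snd e"]
  by (simp add: path_image_compose curve_def heights_def closed_segment_eq_real_ivl)

lemma upward_planar_drawing_curve:
  assumes "pverts G = V" "parcs G = E"
  shows "upward_planar_drawing G p curve"
proof -
  have mono: "strict_mono_on {0..1} (snd \<circ> curve e)" if "e \<in> E" for e
  proof -
    define a b where "a = snd (p (fst e))" and "b = snd (p (snd e))"
    have "a < b" using up[of "fst e" "snd e"] that by (simp add: a_def b_def)
    have "snd (curve e t) = a + t * (b - a)" for t
      by (simp add: curve_def linepath_def a_def b_def algebra_simps)
    then show ?thesis using \<open>a < b\<close> by (auto simp: strict_mono_on_def)
  qed
  have "arc (curve e)" if "e \<in> E" for e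
  proof -
    have "continuous_on (heights e) (F e)"
      using cont[of "fst e" "snd e"] that by (simp add: heights_def)
    moreover have "path_image (linepath (snd (p (fst e))) (snd (p (snd e)))) = heights e"
      using up[of "fst e" "snd e"] that by (simp add: heights_def closed_segment_eq_real_ivl)
    ultimately have "path (curve e)"
      unfolding curve_def by (intro path_continuous_image) (auto intro!: continuous_intros)
    moreover have "inj_on (snd \<circ> curve e) {0..1}"
      using mono[OF that] by (rule strict_mono_on_imp_inj_on)
    ultimately show ?thesis unfolding arc_def by (auto intro: inj_on_imageI2)
  qed
  moreover have "pathstart (curve (u, v)) = p u" "pathfinish (curve (u, v)) = p v"
    if "(u, v) \<in> E" for u v
    using ends[OF that] by (simp_all add: curve_def pathstart_compose pathfinish_compose)
  moreover have "w = u \<or> w = v" if "(u, v) \<in> E" "w \<in> V" "p w \<in> path_image (curve (u, v))" for u v w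
    using that avoid[of u v w] by (auto simp: path_image_curve heights_def)
  moreover have disj: "path_image (curve (u, v)) \<inter> path_image (curve (w, z)) \<subseteq> p ` ({u, v} \<inter> {w, z})"
    if "(u, v) \<in> E" "(w, z) \<in> E" "(u, v) \<noteq> (w, z)" for u v w z
    using meet[OF that] that by (auto simp: path_image_curve heights_def)
  have "\<forall>(u, v) \<in> E. \<forall>(w, z) \<in> E. (u, v) \<noteq> (w, z) \<longrightarrow>
      path_image (curve (u, v)) \<inter> path_image (curve (w, z)) \<subseteq> p ` ({u, v} \<inter> {w, z})"
    by (intro ballI case_prodI2 impI) (rule disj; simp)
  ultimately show ?thesis
    unfolding upward_planar_drawing_def planar_drawing_def assms using inj mono
    by (intro conjI) fast+
qed

end

text \<open>On the compact interval \<open>{0..1}\<close> the strictly increasing height has a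
  continuous inverse \<open>j\<close>; the required function is
  \<open>fst \<circ> g \<circ> j\<close>.\<close>

lemma upward_arc_graph:
  fixes g :: "real \<Rightarrow> real \<times> real"
  assumes "path g" "strict_mono_on {0..1} (snd \<circ> g)"
  shows "\<exists>f. continuous_on {snd (pathstart g)..snd (pathfinish g)} f \<and>
    path_image g = (\<lambda>h. (f h, h)) ` {snd (pathstart g)..snd (pathfinish g)}"
proof -
  define k where "k = snd \<circ> g"
  define j where "j = the_inv_into {0..1} k"
  have k: "continuous_on {0..1} k" "inj_on k {0..1}"
    using assms(1) strict_mono_on_imp_inj_on[OF assms(2)]
    by (auto simp: k_def path_def comp_def intro: continuous_on_snd)
  have image: "k ` {0..1} = {k 0..k 1}"
  proof
    show "k ` {0..1} \<subseteq> {k 0..k 1}"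
      using strict_mono_on_leD[OF assms(2)] by (auto simp: k_def)
    show "{k 0..k 1} \<subseteq> k ` {0..1}"
      using IVT'[of k 0 _ 1] k(1) by force
  qed
  have "continuous_on {k 0..k 1} j"
    using continuous_on_inv_into[OF k(1) _ k(2)] by (simp add: image j_def)
  moreover have "j ` {k 0..k 1} \<subseteq> {0..1}"
    unfolding j_def image[symmetric] using k(2) by (auto simp: the_inv_into_f_f)
  ultimately have "continuous_on {k 0..k 1} (g \<circ> j)"
    using assms(1) by (intro continuous_on_compose) (auto simp: path_def intro: continuous_on_subset)
  then have "continuous_on {k 0..k 1} (fst \<circ> (g \<circ> j))"
    by (simp add: comp_def continuous_on_fst)
  moreover have "g t = ((fst \<circ> (g \<circ> j)) (k t), k t)" if "t \<in> {0..1}" for t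
    using the_inv_into_f_f[OF k(2) that] by (simp add: j_def) (simp add: k_def)
  then have "g ` {0..1} = (\<lambda>h. ((fst \<circ> (g \<circ> j)) h, h)) ` k ` {0..1}"
    by (simp add: image_image)
  then have "path_image g = (\<lambda>h. ((fst \<circ> (g \<circ> j)) h, h)) ` {k 0..k 1}"
    by (simp only: image path_image_def)
  ultimately have "\<exists>f. continuous_on {k 0..k 1} f \<and> path_image g = (\<lambda>h. (f h, h)) ` {k 0..k 1}"
    by (intro exI conjI)
  then show ?thesis by (simp add: k_def pathstart_def pathfinish_def)
qed

lemma upward_planar_drawing_level:
  assumes "upward_planar_drawing G p \<gamma>" "parcs G \<subseteq> pverts G \<times> pverts G"
  obtains F where "level_drawing (pverts G) (parcs G) p F"
    "\<And>u v. (u, v) \<in> parcs G \<Longrightarrow>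
      path_image (\<gamma> (u, v)) = (\<lambda>h. (F (u, v) h, h)) ` {snd (p u)..snd (p v)}"
proof -
  note drawing = assms(1)[unfolded upward_planar_drawing_def planar_drawing_def]
  note edges = drawing[THEN conjunct1, THEN conjunct2, THEN conjunct1]
    and pairs = drawing[THEN conjunct1, THEN conjunct2, THEN conjunct2]
    and mono = drawing[THEN conjunct2]
    and inj = drawing[THEN conjunct1, THEN conjunct1]
  have arc: "arc (\<gamma> (u, v))" "pathstart (\<gamma> (u, v)) = p u" "pathfinish (\<gamma> (u, v)) = p v"
      "\<And>w. w \<in> pverts G \<Longrightarrow> p w \<in> path_image (\<gamma> (u, v)) \<Longrightarrow> w = u \<or> w = v"
    if "(u, v) \<in> parcs G" for u v
    using bspec[OF edges that] by auto
  have disj: "path_image (\<gamma> (u, v)) \<inter> path_image (\<gamma> (w, z)) \<subseteq> p ` ({u, v} \<inter> {w, z})"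
    if "(u, v) \<in> parcs G" "(w, z) \<in> parcs G" "(u, v) \<noteq> (w, z)" for u v w z
    using bspec[OF pairs that(1)] that(2,3) by fast
  have "\<forall>e\<in>parcs G. \<exists>f. continuous_on {snd (p (fst e))..snd (p (snd e))} f \<and>
      path_image (\<gamma> e) = (\<lambda>h. (f h, h)) ` {snd (p (fst e))..snd (p (snd e))}"
  proof
    fix e assume e: "e \<in> parcs G"
    then have "(fst e, snd e) \<in> parcs G" by simp
    note arc = arc(1-3)[OF this]
    show "\<exists>f. continuous_on {snd (p (fst e))..snd (p (snd e))} f \<and>
      path_image (\<gamma> e) = (\<lambda>h. (f h, h)) ` {snd (p (fst e))..snd (p (snd e))}"
      using upward_arc_graph[OF arc_imp_path[OF arc(1)]] arc(2,3) bspec[OF mono e] by simp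
  qed
  from bchoice[OF this] obtain F
    where F: "\<forall>e\<in>parcs G. continuous_on {snd (p (fst e))..snd (p (snd e))} (F e) \<and>
      path_image (\<gamma> e) = (\<lambda>h. (F e h, h)) ` {snd (p (fst e))..snd (p (snd e))}" by (rule exE)
  have contF: "continuous_on {snd (p u)..snd (p v)} (F (u, v))"
    and imageF: "path_image (\<gamma> (u, v)) = (\<lambda>h. (F (u, v) h, h)) ` {snd (p u)..snd (p v)}"
    if "(u, v) \<in> parcs G" for u v
    using bspec[OF F that] by simp_all
  show thesis
  proof
    show "level_drawing (pverts G) (parcs G) p F"
    proof
      show "parcs G \<subseteq> pverts G \<times> pverts G" by fact
      show "inj_on p (pverts G)" by fact
      fix u v assume uv: "(u, v) \<in> parcs G"
      show "snd (p u) < snd (p v)"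
        using strict_mono_onD[OF bspec[OF mono uv], of 0 1] arc(2,3)[OF uv]
        by (simp add: pathstart_def pathfinish_def)
      show "continuous_on {snd (p u)..snd (p v)} (F (u, v))"
        by (rule contF[OF uv])
      have "p u \<in> path_image (\<gamma> (u, v))" "p v \<in> path_image (\<gamma> (u, v))"
        using arc(2,3)[OF uv] by (metis pathstart_in_path_image pathfinish_in_path_image)+
      then show "F (u, v) (snd (p u)) = fst (p u)" "F (u, v) (snd (p v)) = fst (p v)"
        unfolding imageF[OF uv] by auto
      show "w = u \<or> w = v" if "w \<in> pverts G" "snd (p w) \<in> {snd (p u)..snd (p v)}"
        "F (u, v) (snd (p w)) = fst (p w)" for w
      proof (rule arc(4)[OF uv that(1)])
        show "p w \<in> path_image (\<gamma> (u, v))"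
          unfolding imageF[OF uv] using that by (auto simp: image_iff prod_eq_iff intro!: bexI[of _ "snd (p w)"])
      qed
      show "(F (u, v) h, h) \<in> p ` ({u, v} \<inter> {w, z})"
        if "(w, z) \<in> parcs G" "(u, v) \<noteq> (w, z)" "h \<in> {snd (p u)..snd (p v)}"
          "h \<in> {snd (p w)..snd (p z)}" "F (u, v) h = F (w, z) h" for w z h
      proof -
        have "(F (u, v) h, h) \<in> path_image (\<gamma> (u, v))" "(F (w, z) h, h) \<in> path_image (\<gamma> (w, z))"
          using that(3,4) unfolding imageF[OF uv] imageF[OF that(1)] by auto
        then show ?thesis using subsetD[OF disj[OF uv that(1,2)]] that(5) by auto
      qed
    qed
  qed (rule imageF)
qed

lemma upward_embedding_sweep:
  assumes "upward_planar_drawing G p \<gamma>" "induces_embedding G p \<gamma> \<E>"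
    and G: "finite (pverts G)" "parcs G \<subseteq> pverts G \<times> pverts G"
  shows "\<exists>vs. distinct vs \<and> set vs = pverts G \<and> sorted_wrt (\<lambda>a b. (b, a) \<notin> parcs G) vs \<and>
    sweep (\<lambda>v. map (\<lambda>u. (u, v)) (preds \<E> v)) (\<lambda>v. map (Pair v) (succs \<E> v)) [] vs"
proof -
  obtain F where level: "level_drawing (pverts G) (parcs G) p F"
    and image: "\<And>u v. (u, v) \<in> parcs G \<Longrightarrow>
      path_image (\<gamma> (u, v)) = (\<lambda>h. (F (u, v) h, h)) ` {snd (p u)..snd (p v)}"
    using upward_planar_drawing_level[OF assms(1) G(2)] by blast
  interpret level_drawing "pverts G" "parcs G" p F by (rule level)
  \<comment> \<open>\<open>left_of_around\<close> controls only heights near that of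
    \<open>a\<close> and different from it; a single common height of this kind already gives
    \<open>left\<close>.\<close>
  have leftI: "left e f"
    if ef: "e \<in> parcs G" "f \<in> parcs G" "left_of_around \<gamma> a e f"
      and near: "\<And>\<epsilon>. \<epsilon> > 0 \<Longrightarrow> \<exists>h \<in> heights e \<inter> heights f. h \<noteq> snd a \<and> \<bar>h - snd a\<bar> < \<epsilon>" for e f a
  proof -
    obtain \<epsilon> where \<epsilon>: "\<epsilon> > 0" "\<forall>q \<in> path_image (\<gamma> e). \<forall>r \<in> path_image (\<gamma> f).
        snd q = snd r \<and> 0 < \<bar>snd q - snd a\<bar> \<and> \<bar>snd q - snd a\<bar> < \<epsilon> \<longrightarrow> fst q < fst r"
      using ef(3) unfolding left_of_around_def by blast
    obtain h where h: "h \<in> heights e" "h \<in> heights f" "h \<noteq> snd a" "\<bar>h - snd a\<bar> < \<epsilon>"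
      using near[OF \<epsilon>(1)] by auto
    have "(F e h, h) \<in> path_image (\<gamma> e)" "(F f h, h) \<in> path_image (\<gamma> f)"
      using image[of "fst e" "snd e"] image[of "fst f" "snd f"] ef h by (auto simp: heights_def)
    with \<epsilon>(2) h have "F e h < F f h" by force
    with h show ?thesis by (auto simp: left_def)
  qed
  have out: "left (v, w) (v, z)"
    if "(v, w) \<in> parcs G" "(v, z) \<in> parcs G" "left_of_around \<gamma> (p v) (v, w) (v, z)" for v w z
  proof (rule leftI[OF that])
    fix \<epsilon> :: real assume "\<epsilon> > 0"
    \<comment> \<open>Less than \<open>\<epsilon>\<close>, and small enough that both edges still
      reach this height.\<close>
    define d where "d = min (\<epsilon> / 2) (min (snd (p w) - snd (p v)) (snd (p z) - snd (p v)))"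
    have "0 < d" "d < \<epsilon>" "d \<le> snd (p w) - snd (p v)" "d \<le> snd (p z) - snd (p v)"
      using up that \<open>\<epsilon> > 0\<close> by (auto simp: d_def)
    then show "\<exists>h \<in> heights (v, w) \<inter> heights (v, z). h \<noteq> snd (p v) \<and> \<bar>h - snd (p v)\<bar> < \<epsilon>"
      by (intro bexI[of _ "snd (p v) + d"]) (auto simp: heights_def)
  qed
  have into: "left (u, v) (w, v)"
    if "(u, v) \<in> parcs G" "(w, v) \<in> parcs G" "left_of_around \<gamma> (p v) (u, v) (w, v)" for u v w
  proof (rule leftI[OF that])
    fix \<epsilon> :: real assume "\<epsilon> > 0"
    define d where "d = min (\<epsilon> / 2) (min (snd (p v) - snd (p u)) (snd (p v) - snd (p w)))"
    have "0 < d" "d < \<epsilon>" "d \<le> snd (p v) - snd (p u)" "d \<le> snd (p v) - snd (p w)"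
      using up that \<open>\<epsilon> > 0\<close> by (auto simp: d_def)
    then show "\<exists>h \<in> heights (u, v) \<inter> heights (w, v). h \<noteq> snd (p v) \<and> \<bar>h - snd (p v)\<bar> < \<epsilon>"
      by (intro bexI[of _ "snd (p v) - d"]) (auto simp: heights_def)
  qed
  obtain us where us: "set us = pverts G" "distinct us"
    using finite_distinct_list[OF G(1)] by blast
  define vs where "vs = sort_key (snd \<circ> p) us"
  have vs: "set vs = pverts G" "distinct vs" "sorted (map (snd \<circ> p) vs)"
    using us by (simp_all add: vs_def)
  have emb: "distinct (succs \<E> v)" "set (succs \<E> v) = {w. (v, w) \<in> parcs G}"
    "sorted_wrt (\<lambda>w z. left_of_around \<gamma> (p v) (v, w) (v, z)) (succs \<E> v)"
    "distinct (preds \<E> v)" "set (preds \<E> v) = {u. (u, v) \<in> parcs G}"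
    "sorted_wrt (\<lambda>u w. left_of_around \<gamma> (p v) (u, v) (w, v)) (preds \<E> v)" if "v \<in> pverts G" for v
    using assms(2) that unfolding induces_embedding_def by blast+
  have "sweep (\<lambda>v. map (\<lambda>u. (u, v)) (preds \<E> v)) (\<lambda>v. map (Pair v) (succs \<E> v)) [] vs"
  proof (rule sweep_by_height[where P = "{}"])
    show "\<forall>v\<in>pverts G. distinct (succs \<E> v) \<and> set (succs \<E> v) = {w. (v, w) \<in> parcs G} \<and>
      sorted_wrt (\<lambda>w z. left (v, w) (v, z)) (succs \<E> v)"
    proof (intro ballI conjI)
      fix v assume v: "v \<in> pverts G"
      show "sorted_wrt (\<lambda>w z. left (v, w) (v, z)) (succs \<E> v)"
        by (rule sorted_wrt_mono_rel[OF _ emb(3)[OF v]]) (use emb(2)[OF v] out in auto)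
    qed (use emb in auto)
    show "\<forall>v\<in>pverts G. distinct (preds \<E> v) \<and> set (preds \<E> v) = {u. (u, v) \<in> parcs G} \<and>
      sorted_wrt (\<lambda>u w. left (u, v) (w, v)) (preds \<E> v)"
    proof (intro ballI conjI)
      fix v assume v: "v \<in> pverts G"
      show "sorted_wrt (\<lambda>u w. left (u, v) (w, v)) (preds \<E> v)"
        by (rule sorted_wrt_mono_rel[OF _ emb(6)[OF v]]) (use emb(5)[OF v] into in auto)
    qed (use emb in auto)
  qed (use vs in auto)
  moreover have "sorted_wrt (\<lambda>a b. (b, a) \<notin> parcs G) vs"
    using vs(3) unfolding sorted_map by (rule sorted_wrt_mono_rel[rotated]) (use up in force)
  ultimately show ?thesis using vs by blast
qed

section \<open>From L-drawings to embeddings\<close>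

text \<open>The \<open>x\<close>-coordinate at height \<open>h\<close> of a perturbed L-shaped edge from \<open>(a, b)\<close> to \<open>(c, d)\<close>: it
  drifts by at most \<open>1/4\<close> towards \<open>c\<close> up to height \<open>d - 1/4\<close> and then runs to the head. Among the
  edges with a common tail on the same side a higher head drifts more slowly, and among those with
  a common head a more distant tail arrives more slowly; this separates overlapping segments.\<close>

definition bent :: "real \<Rightarrow> real \<Rightarrow> real \<Rightarrow> real \<Rightarrow> real \<Rightarrow> real" where
  "bent a b c d h = a + sgn (c - a) *
     ((h - b) / (4 * (d - b)) + (\<bar>c - a\<bar> - 1/4) * max 0 (1 - 4 * (d - h)))"

lemma bent_low:
  assumes "h \<le> d - 1/4"
  shows "bent a b c d h = a + sgn (c - a) * ((h - b) / (4 * (d - b)))"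
proof -
  have "max 0 (1 - 4 * (d - h)) = 0" using assms by simp
  then show ?thesis by (simp add: bent_def)
qed

text \<open>The last quarter seen from the head. Covering \<open>\<bar>c - a\<bar> - 1/4\<close>
  within height \<open>1/4\<close> contributes \<open>4 * \<bar>c - a\<bar> - 1\<close> to the
  slope, and the slow drift, which continues, contributes \<open>1 / (4 * (d - b))\<close>.\<close>

lemma bent_high:
  assumes "h \<ge> d - 1/4" "b < d"
  shows "bent a b c d h =
    c - sgn (c - a) * ((d - h) * (4 * \<bar>c - a\<bar> - 1 + 1 / (4 * (d - b))))"
proof -
  have 1: "(h - b) / (4 * (d - b)) = 1/4 - (d - h) / (4 * (d - b))"
    using assms(2) by (simp add: field_simps)
  have 2: "c = a + sgn (c - a) * \<bar>c - a\<bar>"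
    by (simp add: sgn_if abs_if)
  have 3: "max 0 (1 - 4 * (d - h)) = 1 - 4 * (d - h)"
    using assms(1) by simp
  have "bent a b c d h = a + sgn (c - a) *
      (1/4 - (d - h) / (4 * (d - b)) + (\<bar>c - a\<bar> - 1/4) * (1 - 4 * (d - h)))"
    unfolding bent_def 1 3 ..
  also have "\<dots> = (a + sgn (c - a) * \<bar>c - a\<bar>) -
      sgn (c - a) * ((d - h) * (4 * \<bar>c - a\<bar> - 1 + 1 / (4 * (d - b))))"
    by (simp add: algebra_simps)
  finally show ?thesis using 2 by simp
qed

lemma bent_tail: "b + 1 \<le> d \<Longrightarrow> bent a b c d b = a"
  by (simp add: bent_def max_def)

lemma bent_head: "b + 1 \<le> d \<Longrightarrow> bent a b c d d = c"
  by (simp add: bent_high)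

text \<open>Bounds valid on both pieces at once: the edge is at least as far out as its slow drift
  and never beyond its head.\<close>

lemma bent_offset:
  assumes "b \<le> h" "h \<le> d" "b < d" "\<bar>c - a\<bar> \<ge> 1"
  obtains t where "(h - b) / (4 * (d - b)) \<le> t" "t \<le> \<bar>c - a\<bar>" "bent a b c d h = a + sgn (c - a) * t"
proof
  let ?m = "max 0 (1 - 4 * (d - h))"
  have "(h - b) / (4 * (d - b)) \<le> 1/4" using assms by (simp add: field_simps)
  moreover have "0 \<le> ?m" "?m \<le> 1" using assms by auto
  then have "0 \<le> (\<bar>c - a\<bar> - 1/4) * ?m" "(\<bar>c - a\<bar> - 1/4) * ?m \<le> \<bar>c - a\<bar> - 1/4"
    using assms(4) by (auto intro!: mult_nonneg_nonneg mult_left_le)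
  ultimately show "(h - b) / (4 * (d - b)) \<le> (h - b) / (4 * (d - b)) + (\<bar>c - a\<bar> - 1/4) * ?m"
    "(h - b) / (4 * (d - b)) + (\<bar>c - a\<bar> - 1/4) * ?m \<le> \<bar>c - a\<bar>" by linarith+
  show "bent a b c d h = a + sgn (c - a) * ((h - b) / (4 * (d - b)) + (\<bar>c - a\<bar> - 1/4) * ?m)"
    by (simp add: bent_def)
qed

lemma bent_low_near:
  assumes "b \<le> h" "h \<le> d - 1/4" "b < d"
  shows "\<bar>bent a b c d h - a\<bar> \<le> 1/4"
proof -
  define t where "t = (h - b) / (4 * (d - b))"
  have "0 \<le> t" "t \<le> 1/4"
    unfolding t_def using assms by (simp_all add: field_simps)
  moreover have "bent a b c d h = a + sgn (c - a) * t"
    unfolding t_def by (rule bent_low[OF assms(2)])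
  ultimately show ?thesis by (simp add: sgn_if)
qed

text \<open>The edge with the higher head is still drifting at \<open>h\<close>, and more slowly
  than the drift of the other, which may already be in its final run and is then even farther out.
  On opposite sides of the tail the sign separates them.\<close>

lemma bent_common_tail:
  assumes "b < h" "h \<le> d" "d + 1 \<le> d'" "\<bar>c - a\<bar> \<ge> 1" "\<bar>c' - a\<bar> \<ge> 1"
  shows "bent a b c d h \<noteq> bent a b c' d' h"
proof -
  obtain t where t: "(h - b) / (4 * (d - b)) \<le> t" "bent a b c d h = a + sgn (c - a) * t"
    using bent_offset[of b h d c a] assms by auto
  define t' where "t' = (h - b) / (4 * (d' - b))"
  have t': "bent a b c' d' h = a + sgn (c' - a) * t'"
    unfolding t'_def using assms by (intro bent_low) auto
  have "0 < t'" "t' < (h - b) / (4 * (d - b))"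
    unfolding t'_def using assms by (auto intro!: divide_strict_left_mono divide_pos_pos mult_pos_pos)
  then show ?thesis using t t' assms by (auto simp: sgn_if split: if_splits)
qed

text \<open>Below the last quarter both edges stay within \<open>1/4\<close> of columns at least 1
  apart. In the last quarter they are straight lines through the head: on opposite sides the signs
  of their slopes differ, and on the same side the terms \<open>4 * \<bar>c - a\<bar>\<close> differ
  by at least 4, more than the drifts of at most \<open>1/4\<close> can compensate.\<close>

lemma bent_common_head:
  assumes "b \<le> h" "b' \<le> h" "h \<le> d" "b + 1 \<le> d" "b' + 1 \<le> d"
    and "\<bar>c - a\<bar> \<ge> 1" "\<bar>c - a'\<bar> \<ge> 1" "\<bar>a - a'\<bar> \<ge> 1"
    and eq: "bent a b c d h = bent a' b' c d h"
  shows "h = d"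
proof (cases "h \<le> d - 1/4")
  case True
  have "\<bar>bent a b c d h - a\<bar> \<le> 1/4"
    by (rule bent_low_near) (use True assms in linarith)+
  moreover have "\<bar>bent a' b' c d h - a'\<bar> \<le> 1/4"
    by (rule bent_low_near) (use True assms in linarith)+
  ultimately show ?thesis using assms(8) eq by (simp add: abs_if split: if_splits)
next
  case False
  define r r' where "r = 1 / (4 * (d - b))" and "r' = 1 / (4 * (d - b'))"
  define K K' where "K = 4 * \<bar>c - a\<bar> - 1 + r" and "K' = 4 * \<bar>c - a'\<bar> - 1 + r'"
  have frac: "0 < r" "r \<le> 1/4" "0 < r'" "r' \<le> 1/4"
    using assms(4,5) by (simp_all add: r_def r'_def field_simps)
  have "sgn (c - a) * ((d - h) * K) = sgn (c - a') * ((d - h) * K')"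
    using eq False assms(4,5) by (simp add: bent_high K_def K'_def r_def r'_def)
  then have "(d - h) * (sgn (c - a) * K - sgn (c - a') * K') = 0"
    by (simp add: algebra_simps)
  moreover have "sgn (c - a) * K - sgn (c - a') * K' \<noteq> 0"
    using frac assms(6-8) unfolding K_def K'_def by (auto simp: sgn_if abs_if split: if_splits)
  ultimately show ?thesis by simp
qed

lemma bent_between:
  assumes "b \<le> h" "h \<le> d" "b < d" "\<bar>c - a\<bar> \<ge> 1"
  shows "min a c \<le> bent a b c d h" "bent a b c d h \<le> max a c"
proof -
  obtain t where "(h - b) / (4 * (d - b)) \<le> t" "t \<le> \<bar>c - a\<bar>" "bent a b c d h = a + sgn (c - a) * t"
    using bent_offset[OF assms] by blast
  moreover have "0 \<le> (h - b) / (4 * (d - b))" using assms by simp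
  ultimately show "min a c \<le> bent a b c d h" "bent a b c d h \<le> max a c"
    using assms(4) by (auto simp: sgn_if abs_if min_def max_def split: if_splits)
qed

section \<open>The perturbed L-drawing as a level drawing\<close>

definition L_level :: "('a \<Rightarrow> int) \<Rightarrow> ('a \<Rightarrow> int) \<Rightarrow> 'a \<times> 'a \<Rightarrow> real \<Rightarrow> real" where
  "L_level x y e = bent (x (fst e)) (y (fst e)) (x (snd e)) (y (snd e))"

lemma of_int_gap:
  fixes m n :: int
  assumes "m \<noteq> n"
  shows "1 \<le> \<bar>real_of_int m - real_of_int n\<bar>"
  using assms by linarith

text \<open>With no common tail or head, \<open>h\<close> is at least 1 below \<open>z\<close>, so
  the second edge is within \<open>1/4\<close> of the column of \<open>w\<close>. The first edge
  stays between the columns of \<open>u\<close> and \<open>v\<close>, and unless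
  \<open>v = w\<close> the column of \<open>w\<close> is at least 1 outside that range, as it does
  not block.\<close>

lemma L_level_meet:
  fixes x y :: "'a \<Rightarrow> int" and h :: real
  assumes E: "E \<subseteq> V \<times> V" "\<forall>(u, v)\<in>E. y u < y v"
    and inj: "inj_on x V" "inj_on y V"
    and free: "\<forall>e\<in>E. \<forall>f\<in>E. \<not> blocks x y e f"
    and e: "(u, v) \<in> E" and f: "(w, z) \<in> E" and ne: "(u, v) \<noteq> (w, z)"
    and h: "y u \<le> h" "h \<le> y v" "y w \<le> h" "h \<le> y z"
    and eq: "L_level x y (u, v) h = L_level x y (w, z) h"
    and order: "y v \<le> y z"
  shows "u = w \<and> h = y u \<or> v = z \<and> h = y v \<or> v = w \<and> h = y v"
proof -
  have V: "u \<in> V" "v \<in> V" "w \<in> V" "z \<in> V" using e f E by auto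
  have up: "y u < y v" "y w < y z" using e f E by auto
  then have up1: "real_of_int (y u) + 1 \<le> y v" "real_of_int (y w) + 1 \<le> y z"
    by linarith+
  have ne_x: "x a \<noteq> x b" if "a \<in> V" "b \<in> V" "a \<noteq> b" for a b
    using that inj by (auto dest: inj_onD)
  have gap: "1 \<le> \<bar>real_of_int (x a) - x b\<bar>" if "a \<in> V" "b \<in> V" "a \<noteq> b" for a b
    using ne_x[OF that] by (rule of_int_gap)
  have "u \<noteq> v" "w \<noteq> z" using up by auto
  note gaps = gap[OF V(2,1)] gap[OF V(4,3)] this
  have eq': "bent (x u) (y u) (x v) (y v) h = bent (x w) (y w) (x z) (y z) h"
    using eq by (simp add: L_level_def)
  consider "u = w" | "u \<noteq> w" "v = z" | "u \<noteq> w" "v \<noteq> z" by blast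
  then show ?thesis
  proof cases
    case 1
    then have "y v \<noteq> y z" using ne V inj by (auto dest: inj_onD)
    then have "real_of_int (y v) + 1 \<le> y z" using order by linarith
    then have "y u < h \<Longrightarrow> bent (x u) (y u) (x v) (y v) h \<noteq> bent (x u) (y u) (x z) (y z) h"
      using bent_common_tail[of "y u" h "y v" "y z" "x v" "x u" "x z"] 1 h(2) gaps by simp
    then have "\<not> y u < h" using eq' 1 by auto
    then have "h = y u" using h(1) by simp
    then show ?thesis using 1 by simp
  next
    case 2
    have "h = y v"
      by (rule bent_common_head[of "y u" h "y w" "y v" "x v" "x u" "x w"])
        (use h up1 gaps gap[OF V(1,3)] eq' 2 in auto)
    then show ?thesis using 2 by auto
  next
    case 3
    then have "y v \<noteq> y z" using V inj by (auto dest: inj_onD)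
    then have vz: "y v < y z" "real_of_int (y v) + 1 \<le> y z" using order by linarith+
    have near: "\<bar>bent (x w) (y w) (x z) (y z) h - x w\<bar> \<le> 1/4"
      using h vz up1 by (intro bent_low_near) auto
    have uw: "1 \<le> \<bar>real_of_int (x u) - x w\<bar>" using gap[OF V(1,3)] 3 by simp
    show ?thesis
    proof (cases "v = w")
      case True
      then show ?thesis using h by auto
    next
      case False
      have "y w \<le> y v" using h by linarith
      moreover have "y w \<noteq> y v" using False V inj by (auto dest: inj_onD)
      ultimately have "y w < y v" by simp
      then have "\<not> (x u < x w \<and> x w < x v)" "\<not> (x v < x w \<and> x w < x u)"
        using free e f vz(1) by (force simp: blocks_def)+
      moreover have "x u \<noteq> x w" "x v \<noteq> x w" using ne_x V 3 False by auto
      ultimately have "x w + 1 \<le> min (x u) (x v) \<or> max (x u) (x v) + 1 \<le> x w"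
        by linarith
      then have "real_of_int (x w) + 1 \<le> min (x u) (x v) \<or> max (x u) (x v) + 1 \<le> real_of_int (x w)"
        by linarith
      moreover have "min (x u) (x v) \<le> bent (x u) (y u) (x v) (y v) h"
        "bent (x u) (y u) (x v) (y v) h \<le> max (x u) (x v)"
        using bent_between[of "y u" h "y v" "x v" "x u"] h up gaps by auto
      ultimately have False using near eq' by (auto simp: abs_if split: if_splits)
      then show ?thesis ..
    qed
  qed
qed

lemma level_drawing_L_level:
  fixes x y :: "'a \<Rightarrow> int"
  assumes E: "E \<subseteq> V \<times> V" "\<forall>(u, v)\<in>E. y u < y v"
    and inj: "inj_on x V" "inj_on y V"
    and free: "\<forall>e\<in>E. \<forall>f\<in>E. \<not> blocks x y e f"
  shows "level_drawing V E (L_point x y) (L_level x y)"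
proof
  show "E \<subseteq> V \<times> V" by fact
  show "inj_on (L_point x y) V"
    using inj by (auto simp: L_point_def inj_on_def)
  fix u v assume uv: "(u, v) \<in> E"
  have V: "u \<in> V" "v \<in> V" using uv E by auto
  have "y u < y v" using uv E by auto
  then have up: "real_of_int (y u) + 1 \<le> y v" by linarith
  show "snd (L_point x y u) < snd (L_point x y v)"
    using up by (simp add: L_point_def)
  have "continuous_on UNIV (bent a b c d)" for a b c d
    unfolding bent_def divide_inverse by (intro continuous_intros)
  then show "continuous_on {snd (L_point x y u)..snd (L_point x y v)} (L_level x y (u, v))"
    unfolding L_level_def by (rule continuous_on_subset) simp
  show "L_level x y (u, v) (snd (L_point x y u)) = fst (L_point x y u)"
    "L_level x y (u, v) (snd (L_point x y v)) = fst (L_point x y v)"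
    using bent_tail[OF up] bent_head[OF up] by (simp_all add: L_level_def L_point_def)
  show "w = u \<or> w = v" if w: "w \<in> V" "snd (L_point x y w) \<in> {snd (L_point x y u)..snd (L_point x y v)}"
    "L_level x y (u, v) (snd (L_point x y w)) = fst (L_point x y w)" for w
  proof (rule ccontr)
    assume "\<not> (w = u \<or> w = v)"
    \<comment> \<open>By integrality \<open>w\<close> is at least 1 below \<open>v\<close>, where
      the edge is within \<open>1/4\<close> of the column of \<open>u\<close>, and the column of
      \<open>w\<close> is at least 1 away from that.\<close>
    then have "y w \<noteq> y v" "x w \<noteq> x u" using w(1) V inj by (auto dest: inj_onD)
    moreover have "y w \<le> y v" using w(2) by (simp add: L_point_def)
    ultimately have "real_of_int (y w) \<le> y v - 1/4" "1 \<le> \<bar>real_of_int (x w) - x u\<bar>"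
      using of_int_gap[of "x w" "x u"] by linarith+
    then show False
      using bent_low_near[of "y u" "y w" "y v" "x u" "x v"] w(2,3) up
      by (simp add: L_level_def L_point_def)
  qed
  show "(L_level x y (u, v) h, h) \<in> L_point x y ` ({u, v} \<inter> {w, z})"
    if wz: "(w, z) \<in> E" "(u, v) \<noteq> (w, z)" "h \<in> {snd (L_point x y u)..snd (L_point x y v)}"
      "h \<in> {snd (L_point x y w)..snd (L_point x y z)}"
      "L_level x y (u, v) h = L_level x y (w, z) h" for w z h
  proof -
    have h: "y u \<le> h" "h \<le> y v" "y w \<le> h" "h \<le> y z"
      using wz(3,4) by (auto simp: L_point_def)
    have wz_up: "real_of_int (y w) + 1 \<le> y z" using wz(1) E by force
    have "\<exists>a \<in> {u, v} \<inter> {w, z}. h = y a"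
    proof (cases "y v \<le> y z")
      case True
      from L_level_meet[OF E inj free uv wz(1,2) h wz(5) this] show ?thesis by auto
    next
      case False
      then have "y z \<le> y v" by simp
      from L_level_meet[OF E inj free wz(1) uv wz(2)[symmetric] h(3,4,1,2) wz(5)[symmetric] this]
      show ?thesis by auto
    qed
    then obtain a where a: "a \<in> {u, v}" "a \<in> {w, z}" "h = y a" by blast
    have "L_level x y (u, v) (y a) = x a"
      using a(1) bent_tail[OF up] bent_head[OF up] by (auto simp: L_level_def)
    then show ?thesis using a by (auto simp: L_point_def)
  qed
qed

section \<open>Upward L-drawings in terms of coordinates\<close>

lemma L_cross_iff:
  assumes "y (fst e) < y (snd e)" "y (fst f) < y (snd f)"
  shows "L_cross x y e f \<longleftrightarrow> blocks x y e f \<or> blocks x y f e"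
proof -
  have vert: "open_segment (a, b) (a, c) = {a} \<times> open_segment b c" for a b c :: real
    by (auto simp: in_segment algebra_simps)
  have horiz: "open_segment (b, a) (c, a) = open_segment b c \<times> {a}" for a b c :: real
    by (auto simp: in_segment algebra_simps)
  have "({a} \<times> S) \<inter> (T \<times> {b}) \<noteq> {} \<longleftrightarrow> a \<in> T \<and> b \<in> S" for a b :: real and S T
    by auto
  then show ?thesis
    using assms unfolding L_cross_def L_point_def L_bend_def vert horiz blocks_def
    by (auto simp: open_segment_eq_real_ivl)
qed

lemma mono_on_L_edge:
  "mono_on {0..1} (fst \<circ> L_edge x y e) \<longleftrightarrow> x (fst e) \<le> x (snd e)"
  "mono_on {0..1} (snd \<circ> L_edge x y e) \<longleftrightarrow> y (fst e) \<le> y (snd e)"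
proof -
  \<comment> \<open>\<open>+++\<close> traverses each leg in half of the unit interval, so the
    x-coordinate rests until 1/2 and the y-coordinate from 1/2 on.\<close>
  have fst: "fst \<circ> L_edge x y e =
      (\<lambda>t. x (fst e) + max 0 (2 * t - 1) * (real_of_int (x (snd e)) - x (fst e)))"
    by (auto simp: fun_eq_iff L_edge_def joinpaths_def linepath_def L_point_def L_bend_def algebra_simps)
  have snd: "snd \<circ> L_edge x y e =
      (\<lambda>t. y (fst e) + min 1 (2 * t) * (real_of_int (y (snd e)) - y (fst e)))"
    by (auto simp: fun_eq_iff L_edge_def joinpaths_def linepath_def L_point_def L_bend_def algebra_simps)
  show "mono_on {0..1} (fst \<circ> L_edge x y e) \<longleftrightarrow> x (fst e) \<le> x (snd e)"
  proof
    show "x (fst e) \<le> x (snd e)" if "mono_on {0..1} (fst \<circ> L_edge x y e)"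
      using mono_onD[OF that, of 0 1] unfolding fst by simp
    show "mono_on {0..1} (fst \<circ> L_edge x y e)" if "x (fst e) \<le> x (snd e)"
      unfolding fst using that by (intro mono_onI add_left_mono mult_right_mono) auto
  qed
  show "mono_on {0..1} (snd \<circ> L_edge x y e) \<longleftrightarrow> y (fst e) \<le> y (snd e)"
  proof
    show "y (fst e) \<le> y (snd e)" if "mono_on {0..1} (snd \<circ> L_edge x y e)"
      using mono_onD[OF that, of 0 1] unfolding snd by simp
    show "mono_on {0..1} (snd \<circ> L_edge x y e)" if "y (fst e) \<le> y (snd e)"
      unfolding snd using that by (intro mono_onI add_left_mono mult_right_mono) auto
  qed
qed

lemma upward_planar_L_drawing_iff:
  assumes "parcs G \<subseteq> pverts G \<times> pverts G" "\<And>v. (v, v) \<notin> parcs G"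
  shows "upward_planar_L_drawing G x y \<longleftrightarrow>
    inj_on x (pverts G) \<and> inj_on y (pverts G) \<and> (\<forall>(u, v)\<in>parcs G. y u < y v) \<and>
    (\<forall>e\<in>parcs G. \<forall>f\<in>parcs G. \<not> blocks x y e f)"
proof (cases "inj_on x (pverts G) \<and> inj_on y (pverts G)")
  case True
  have ne: "y (fst e) \<noteq> y (snd e)" if "e \<in> parcs G" for e
    using True assms(1) assms(2)[of "fst e"] that by (cases e) (auto dest: inj_onD)
  show ?thesis
  proof (cases "\<forall>e\<in>parcs G. y (fst e) < y (snd e)")
    case up: True
    have "\<not> blocks x y e e" if "e \<in> parcs G" for e
      by (simp add: blocks_def)
    then have "(\<forall>e\<in>parcs G. \<forall>f\<in>parcs G. e \<noteq> f \<longrightarrow> \<not> L_cross x y e f) \<longleftrightarrow>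
        (\<forall>e\<in>parcs G. \<forall>f\<in>parcs G. \<not> blocks x y e f)"
      using up L_cross_iff[of y _ _ x] by metis
    then show ?thesis
      using True up unfolding upward_planar_L_drawing_def planar_L_drawing_def L_drawing_def
      by (auto simp: mono_on_L_edge intro: less_imp_le)
  next
    case False
    then obtain e where "e \<in> parcs G" "\<not> y (fst e) \<le> y (snd e)"
      using ne by (meson less_le)
    then have "\<not> upward_planar_L_drawing G x y" "\<not> (\<forall>(u, v)\<in>parcs G. y u < y v)"
      unfolding upward_planar_L_drawing_def mono_on_L_edge by fastforce+
    then show ?thesis by blast
  qed
qed (auto simp: upward_planar_L_drawing_def planar_L_drawing_def L_drawing_def)

lemma upward_rightward_planar_L_drawing_iff:
  assumes "parcs G \<subseteq> pverts G \<times> pverts G" "\<And>v. (v, v) \<notin> parcs G"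
  shows "upward_rightward_planar_L_drawing G x y \<longleftrightarrow>
    upward_planar_L_drawing G x y \<and> (\<forall>(u, v)\<in>parcs G. x u < x v)"
proof -
  have "x (fst e) < x (snd e) \<longleftrightarrow> x (fst e) \<le> x (snd e)"
    if "inj_on x (pverts G)" "e \<in> parcs G" for e
    using that assms(1) assms(2)[of "fst e"] by (cases e) (auto simp: less_le dest: inj_onD)
  then show ?thesis
    unfolding upward_rightward_planar_L_drawing_def upward_planar_L_drawing_def
      planar_L_drawing_def L_drawing_def mono_on_L_edge
    by (fastforce simp: split_beta)
qed

text \<open>The slope at which the perturbed edge \<open>(v, w)\<close> leaves \<open>v\<close>.\<close>

definition out_slope :: "('a \<Rightarrow> int) \<Rightarrow> ('a \<Rightarrow> int) \<Rightarrow> 'a \<Rightarrow> 'a \<Rightarrow> real" where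
  "out_slope x y v w = sgn (real_of_int (x w) - x v) * (1 / (4 * (real_of_int (y w) - y v)))"

lemma out_slope_eqD:
  assumes "y v < y w" "y v < y z" "x w \<noteq> x v" "x z \<noteq> x v" "out_slope x y v w = out_slope x y v z"
  shows "y w = y z"
proof -
  define r r' where "r = 1 / (4 * (real_of_int (y w) - y v))"
    and "r' = 1 / (4 * (real_of_int (y z) - y v))"
  have "r > 0" "r' > 0" using assms(1,2) by (simp_all add: r_def r'_def)
  then have "r = r'"
    using assms(3-5) unfolding out_slope_def r_def[symmetric] r'_def[symmetric]
    by (auto simp: sgn_if split: if_splits)
  then show ?thesis by (simp add: r_def r'_def)
qed

text \<open>Close to a vertex every perturbed edge is straight, so the edges leaving it, and
  likewise those entering it, are ordered by slope.\<close>

lemma L_drawing_embedding: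
  fixes x y :: "'a \<Rightarrow> int"
  assumes fin: "finite (pverts G)" and E: "parcs G \<subseteq> pverts G \<times> pverts G"
    and upward: "\<forall>(u, v)\<in>parcs G. y u < y v"
    and inj_xy: "inj_on x (pverts G)" "inj_on y (pverts G)"
    and free: "\<forall>e\<in>parcs G. \<forall>f\<in>parcs G. \<not> blocks x y e f"
  shows "\<exists>\<E>. upward_planar_embedding G \<E> \<and> (\<forall>v\<in>pverts G. set (succs \<E> v) = {w. (v, w) \<in> parcs G} \<and>
    sorted_wrt (\<lambda>w z. out_slope x y v w < out_slope x y v z) (succs \<E> v))"
proof -
  interpret level_drawing "pverts G" "parcs G" "L_point x y" "L_level x y"
    by (rule level_drawing_L_level[OF E upward inj_xy free])
  have edge: "u \<in> pverts G" "v \<in> pverts G" "real_of_int (y u) + 1 \<le> y v"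
      "1 \<le> \<bar>real_of_int (x v) - x u\<bar>" if "(u, v) \<in> parcs G" for u v
  proof -
    show V: "u \<in> pverts G" "v \<in> pverts G" using that E by auto
    have "y u < y v" using that upward by auto
    then show "real_of_int (y u) + 1 \<le> y v" by linarith
    have "x v \<noteq> x u" using \<open>y u < y v\<close> V inj_xy by (auto dest: inj_onD)
    then show "1 \<le> \<bar>real_of_int (x v) - x u\<bar>" by (rule of_int_gap)
  qed
  have pathD: "\<exists>h :: real. q = (L_level x y (u, v) h, h) \<and> y u \<le> h \<and> h \<le> y v"
    if "(u, v) \<in> parcs G" "q \<in> path_image (curve (u, v))" for u v q
    using that by (auto simp: path_image_curve heights_def L_point_def)
  \<comment> \<open>The signed coefficient of \<open>d - h\<close> in \<open>bent_high\<close>: the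
    slope measured downwards from the head.\<close>
  define in_slope where "in_slope v u = - (sgn (real_of_int (x v) - x u) *
      (4 * \<bar>real_of_int (x v) - x u\<bar> - 1 + 1 / (4 * (real_of_int (y v) - y u))))" for u v
  have high: "L_level x y (u, v) h = x v + (y v - h) * in_slope v u"
    if "(u, v) \<in> parcs G" "y v - 1/4 \<le> h" for u v and h :: real
    using edge(3)[OF that(1)] that(2) by (simp add: L_level_def in_slope_def bent_high)
  have low: "L_level x y (u, v) h = x u + (h - y u) * out_slope x y u v"
    if "(u, v) \<in> parcs G" "h \<le> y v - 1/4" for u v and h :: real
    using that(2) by (simp add: L_level_def out_slope_def bent_low)
  have out: "left_of_around curve (L_point x y v) (v, w) (v, z)"
    if wz: "(v, w) \<in> parcs G" "(v, z) \<in> parcs G" "out_slope x y v w < out_slope x y v z" for v w z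
    unfolding left_of_around_def
  \<comment> \<open>Heads lie at least 1 above \<open>v\<close>, and an outgoing edge is straight
    until \<open>1/4\<close> below its head.\<close>
  proof (intro exI[of _ "3/4"] conjI ballI impI)
    fix q r assume "q \<in> path_image (curve (v, w))" "r \<in> path_image (curve (v, z))"
      and *: "snd q = snd r \<and> 0 < \<bar>snd q - snd (L_point x y v)\<bar> \<and>
        \<bar>snd q - snd (L_point x y v)\<bar> < 3/4"
    then obtain h h' :: real where "q = (L_level x y (v, w) h, h)" "y v \<le> h"
      "r = (L_level x y (v, z) h', h')"
      using pathD[OF wz(1)] pathD[OF wz(2)] by blast
    then have h: "q = (L_level x y (v, w) h, h)" "r = (L_level x y (v, z) h, h)" "y v \<le> h"
      using * by simp_all
    with * have "0 < h - y v" "h \<le> y w - 1/4" "h \<le> y z - 1/4"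
      using edge(3)[OF wz(1)] edge(3)[OF wz(2)] by (auto simp: L_point_def)
    then show "fst q < fst r"
      using wz by (simp add: h low mult_strict_left_mono)
  qed simp
  have into: "left_of_around curve (L_point x y v) (u, v) (w, v)"
    if uw: "(u, v) \<in> parcs G" "(w, v) \<in> parcs G" "in_slope v u < in_slope v w" for u v w
    unfolding left_of_around_def
  \<comment> \<open>An incoming edge is straight on the last quarter below its head.\<close>
  proof (intro exI[of _ "1/4"] conjI ballI impI)
    fix q r assume "q \<in> path_image (curve (u, v))" "r \<in> path_image (curve (w, v))"
      and *: "snd q = snd r \<and> 0 < \<bar>snd q - snd (L_point x y v)\<bar> \<and>
        \<bar>snd q - snd (L_point x y v)\<bar> < 1/4"
    then obtain h h' :: real where "q = (L_level x y (u, v) h, h)" "h \<le> y v"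
      "r = (L_level x y (w, v) h', h')"
      using pathD[OF uw(1)] pathD[OF uw(2)] by blast
    then have h: "q = (L_level x y (u, v) h, h)" "r = (L_level x y (w, v) h, h)" "h \<le> y v"
      using * by simp_all
    with * have "0 < y v - h" "y v - 1/4 \<le> h"
      by (auto simp: L_point_def)
    then show "fst q < fst r"
      using uw by (simp add: h high mult_strict_left_mono)
  qed simp
  have "\<forall>v\<in>pverts G. \<exists>ws. distinct ws \<and> set ws = {w. (v, w) \<in> parcs G} \<and>
      sorted_wrt (\<lambda>w z. out_slope x y v w < out_slope x y v z) ws"
  proof
    fix v
    have "inj_on (out_slope x y v) {w. (v, w) \<in> parcs G}"
    proof (rule inj_onI, clarify)
      fix w z assume wz: "(v, w) \<in> parcs G" "(v, z) \<in> parcs G" "out_slope x y v w = out_slope x y v z"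
      have "y w = y z"
        by (rule out_slope_eqD[OF _ _ _ _ wz(3)]) (use edge(3,4) wz(1,2) in fastforce)+
      then show "w = z" using inj_xy edge(2)[OF wz(1)] edge(2)[OF wz(2)] by (auto dest: inj_onD)
    qed
    moreover have "finite {w. (v, w) \<in> parcs G}"
      by (rule finite_subset[OF _ fin]) (use E in auto)
    ultimately show "\<exists>ws. distinct ws \<and> set ws = {w. (v, w) \<in> parcs G} \<and>
        sorted_wrt (\<lambda>w z. out_slope x y v w < out_slope x y v z) ws"
      using obtain_sorted_list by metis
  qed
  from bchoice[OF this] obtain su where su: "\<forall>v\<in>pverts G. distinct (su v) \<and>
      set (su v) = {w. (v, w) \<in> parcs G} \<and>
      sorted_wrt (\<lambda>w z. out_slope x y v w < out_slope x y v z) (su v)" by (rule exE)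
  have "\<forall>v\<in>pverts G. \<exists>us. distinct us \<and> set us = {u. (u, v) \<in> parcs G} \<and>
      sorted_wrt (\<lambda>u w. in_slope v u < in_slope v w) us"
  proof
    fix v
    have "inj_on (in_slope v) {u. (u, v) \<in> parcs G}"
    proof (rule inj_onI, clarify, rule ccontr)
      fix u w assume uw: "(u, v) \<in> parcs G" "(w, v) \<in> parcs G" "in_slope v u = in_slope v w" "u \<noteq> w"
      \<comment> \<open>Equal slopes would make both edges coincide on the last quarter; any height
        strictly inside it contradicts \<open>bent_common_head\<close>.\<close>
      define h where "h = real_of_int (y v) - 1/8"
      have "x u \<noteq> x w" using inj_xy edge(1)[OF uw(1)] edge(1)[OF uw(2)] uw(4) by (auto dest: inj_onD)
      note gap = of_int_gap[OF this]
      have "L_level x y (u, v) h = L_level x y (w, v) h"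
        using uw(1-3) by (simp add: high h_def)
      then have "h = y v"
        using bent_common_head[of "y u" h "y w" "y v" "x v" "x u" "x w"]
          edge(3,4)[OF uw(1)] edge(3,4)[OF uw(2)] gap by (simp add: h_def L_level_def)
      then show False by (simp add: h_def)
    qed
    moreover have "finite {u. (u, v) \<in> parcs G}"
      by (rule finite_subset[OF _ fin]) (use E in auto)
    ultimately show "\<exists>us. distinct us \<and> set us = {u. (u, v) \<in> parcs G} \<and>
        sorted_wrt (\<lambda>u w. in_slope v u < in_slope v w) us"
      using obtain_sorted_list by metis
  qed
  from bchoice[OF this] obtain pr where pr: "\<forall>v\<in>pverts G. distinct (pr v) \<and>
      set (pr v) = {u. (u, v) \<in> parcs G} \<and>
      sorted_wrt (\<lambda>u w. in_slope v u < in_slope v w) (pr v)" by (rule exE)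
  define \<E> where "\<E> = \<lparr>succs = su, preds = pr,
    outer_face = {e \<in> parcs G. path_image (curve e) \<subseteq>
      frontier (outside (drawing_image G (L_point x y) curve))}\<rparr>"
  have "induces_embedding G (L_point x y) curve \<E>"
    unfolding induces_embedding_def
  proof (intro conjI ballI)
    fix v assume v: "v \<in> pverts G"
    note su = bspec[OF su v] and pr = bspec[OF pr v]
    show "sorted_wrt (\<lambda>w z. left_of_around curve (L_point x y v) (v, w) (v, z)) (succs \<E> v)"
      using su out by (auto simp: \<E>_def elim!: sorted_wrt_mono_rel[rotated])
    show "sorted_wrt (\<lambda>u w. left_of_around curve (L_point x y v) (u, v) (w, v)) (preds \<E> v)"
      using pr into by (auto simp: \<E>_def elim!: sorted_wrt_mono_rel[rotated])
  qed (use su pr in \<open>auto simp: \<E>_def\<close>)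
  then have "upward_planar_embedding G \<E>"
    unfolding upward_planar_embedding_def using upward_planar_drawing_curve[OF refl refl] by blast
  then show ?thesis using su by (intro exI[of _ \<E>]) (auto simp: \<E>_def)
qed

text \<open>Up to sign a slope is the reciprocal of four times the rise. Among negative slopes a
  larger slope means a higher head, among positive ones a lower head, so the peak is where the sign
  changes.\<close>

lemma sorted_out_slope_bitonic:
  assumes "sorted_wrt (\<lambda>w z. out_slope x y v w < out_slope x y v z) ws"
    and ws: "\<forall>w\<in>set ws. y v < y w \<and> x w \<noteq> x v" "inj_on y (set ws)"
  shows "bitonic y ws" "\<forall>w\<in>set ws. x v < x w \<Longrightarrow> mono_decreasing y ws"
proof -
  have pos: "0 < out_slope x y v w \<longleftrightarrow> x v < x w" "out_slope x y v w < 0 \<longleftrightarrow> x w < x v"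
    if "w \<in> set ws" for w
    using ws(1) that unfolding out_slope_def
    by (auto simp: sgn_if zero_less_divide_iff divide_less_0_iff)
  have right: "y z < y w" if "w \<in> set ws" "z \<in> set ws" "0 < out_slope x y v w"
    "out_slope x y v w < out_slope x y v z" for w z
  proof -
    have "x v < x w" "x v < x z" using that pos(1)[of w] pos(1)[of z] by auto
    then show ?thesis using that ws(1) unfolding out_slope_def by (simp add: sgn_if field_simps)
  qed
  have left: "y w < y z" if "w \<in> set ws" "z \<in> set ws" "out_slope x y v z < 0"
    "out_slope x y v w < out_slope x y v z" for w z
  proof -
    have "x w < x v" "x z < x v" using that pos(2)[of w] pos(2)[of z] by auto
    then show ?thesis using that ws(1) unfolding out_slope_def by (simp add: sgn_if field_simps)
  qed
  define ls rs where "ls = filter (\<lambda>w. out_slope x y v w < 0) ws"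
    and "rs = filter (\<lambda>w. 0 < out_slope x y v w) ws"
  have "filter (\<lambda>w. out_slope x y v w = 0) ws = []"
    using pos ws(1) by (force simp: filter_empty_conv)
  moreover have "sorted (map (out_slope x y v) ws)"
    unfolding sorted_map by (rule sorted_wrt_mono_rel[OF _ assms(1)]) simp
  ultimately have split: "ws = ls @ rs"
    using sorted_map_split[of "out_slope x y v" ws 0] by (simp add: ls_def rs_def)
  have rs: "sorted_wrt (\<lambda>a b. y b < y a) rs"
    by (rule sorted_wrt_mono_rel[OF _ sorted_wrt_filter[OF assms(1), of "\<lambda>w. 0 < out_slope x y v w",
            folded rs_def]])
      (use right in \<open>auto simp: rs_def\<close>)
  have ls: "sorted_wrt (\<lambda>a b. y a < y b) ls"
    by (rule sorted_wrt_mono_rel[OF _ sorted_wrt_filter[OF assms(1), of "\<lambda>w. out_slope x y v w < 0",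
            folded ls_def]])
      (use left in \<open>auto simp: ls_def\<close>)
  show "bitonic y ws"
    unfolding split
  proof (rule bitonic_appendI[OF ls rs])
    assume "ls \<noteq> []" "rs \<noteq> []"
    then have "last ls \<in> set ls" "hd rs \<in> set rs" by auto
    then have "last ls \<in> set ws" "hd rs \<in> set ws" "last ls \<noteq> hd rs"
      by (auto simp: ls_def rs_def)
    then show "y (last ls) \<noteq> y (hd rs)" using ws(2) by (auto dest: inj_onD)
  qed
  assume "\<forall>w\<in>set ws. x v < x w"
  then have "ls = []" using pos by (auto simp: ls_def filter_empty_conv)
  then show "mono_decreasing y ws"
    using rs split by (simp add: mono_decreasing_iff_sorted_wrt)
qed

section \<open>From embeddings to L-drawings\<close>

text \<open>The last vertex of a topological order has no outgoing edge and the first no incoming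
  one, so they are \<open>t\<close> and \<open>s\<close>. When \<open>a\<close> precedes
  \<open>b\<close>, \<open>a\<close> is not the last and \<open>b\<close> not the first.\<close>

lemma topological_order_interior:
  assumes "sorted_wrt (\<lambda>a b. (b, a) \<notin> E) vs" "distinct vs" "E \<subseteq> set vs \<times> set vs" "acyclic E"
    and s: "{v \<in> set vs. \<forall>u. (u, v) \<notin> E} = {s}" and t: "{v \<in> set vs. \<forall>w. (v, w) \<notin> E} = {t}"
  shows "sorted_wrt (\<lambda>a b. (\<exists>w. (a, w) \<in> E) \<and> (\<exists>u. (u, b) \<in> E)) vs"
proof -
  have irrefl: "(v, v) \<notin> E" for v using \<open>acyclic E\<close> by (auto simp: acyclic_def)
  have "vs \<noteq> []" using s by auto
  then obtain bs l where bs: "vs = bs @ [l]" by (metis rev_exhaust)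
  have "(l, w) \<notin> E" for w
    using assms(1,3) irrefl unfolding bs by (auto simp: sorted_wrt_append)
  then have "l \<in> {v \<in> set vs. \<forall>w. (v, w) \<notin> E}" unfolding bs by simp
  then have "l = t" unfolding t by simp
  obtain f cs where cs: "vs = f # cs" using \<open>vs \<noteq> []\<close> by (cases vs) auto
  have "(u, f) \<notin> E" for u
    using assms(1,3) irrefl unfolding cs by auto
  then have "f \<in> {v \<in> set vs. \<forall>u. (u, v) \<notin> E}" unfolding cs by simp
  then have "f = s" unfolding s by simp
  show ?thesis
    unfolding sorted_wrt_iff_nth_less
  proof (intro allI impI conjI)
    fix i j assume ij: "i < j" "j < length vs"
    have "vs ! i \<in> set vs" "vs ! j \<in> set vs" using ij by auto
    moreover have "vs ! i \<noteq> t"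
      using ij \<open>distinct vs\<close> nth_eq_iff_index_eq[of vs i "length bs"] \<open>l = t\<close> unfolding bs
      by (auto simp: nth_append)
    moreover have "vs ! j \<noteq> s"
      using ij \<open>distinct vs\<close> nth_eq_iff_index_eq[of vs j 0] \<open>f = s\<close> unfolding cs by auto
    ultimately show "\<exists>w. (vs ! i, w) \<in> E" "\<exists>u. (u, vs ! j) \<in> E"
      using s t by blast+
  qed
qed

text \<open>\<open>blocks\<close> depends only on the order of the columns, so real columns may be
  replaced by the number of smaller ones.\<close>

lemma int_ranks:
  fixes x :: "'a \<Rightarrow> 'b::linorder"
  assumes "finite V"
  shows "\<exists>r :: 'a \<Rightarrow> int. \<forall>u\<in>V. \<forall>v\<in>V. r u < r v \<longleftrightarrow> x u < x v"
proof (intro exI ballI)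
  let ?r = "\<lambda>v. int (card {w \<in> V. x w < x v})"
  fix u v assume "u \<in> V" "v \<in> V"
  show "?r u < ?r v \<longleftrightarrow> x u < x v"
  proof
    assume "x u < x v"
    then have "{w \<in> V. x w < x u} \<subset> {w \<in> V. x w < x v}" using \<open>u \<in> V\<close> by auto
    then show "?r u < ?r v" using assms by (simp add: psubset_card_mono)
  next
    show "x u < x v" if "?r u < ?r v"
    proof (rule ccontr)
      assume "\<not> x u < x v"
      then have "{w \<in> V. x w < x v} \<subseteq> {w \<in> V. x w < x u}" by auto
      then have "?r v \<le> ?r u" using assms by (simp add: card_mono)
      then show False using that by simp
    qed
  qed
qed

lemma bitonic_pair_columns:
  assumes G: "planar_st_graph G" and emb: "upward_planar_embedding G \<E>" and st: "st_ordering G \<pi>"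
    and bit: "\<forall>v\<in>pverts G. bitonic \<pi> (succs \<E> v)"
  shows "\<exists>x :: 'a \<Rightarrow> int. inj_on x (pverts G) \<and>
    (\<forall>e\<in>parcs G. \<forall>f\<in>parcs G. \<not> blocks x \<pi> e f) \<and>
    ((\<forall>v\<in>pverts G. mono_decreasing \<pi> (succs \<E> v)) \<longrightarrow> (\<forall>(u, v)\<in>parcs G. x u < x v))"
proof -
  define V E where "V = pverts G" and "E = parcs G"
  interpret pair_fin_digraph G using G by (simp add: planar_st_graph_def)
  have fin: "finite V" by (simp add: V_def pair_finite_verts)
  have EV: "E \<subseteq> V \<times> V" by (auto simp: V_def E_def dest: in_arcsD1 in_arcsD2)
  have "acyclic E" using G by (simp add: planar_st_graph_def E_def)
  obtain s t where "{v \<in> pverts G. in_arcs (with_proj G) v = {}} = {s}"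
    "{v \<in> pverts G. out_arcs (with_proj G) v = {}} = {t}"
    using G unfolding planar_st_graph_def by blast
  moreover have "in_arcs (with_proj G) v = {} \<longleftrightarrow> (\<forall>u. (u, v) \<notin> E)"
    "out_arcs (with_proj G) v = {} \<longleftrightarrow> (\<forall>w. (v, w) \<notin> E)" for v
    by (auto simp: in_arcs_def out_arcs_def E_def)
  ultimately have s: "{v \<in> V. \<forall>u. (u, v) \<notin> E} = {s}" and t: "{v \<in> V. \<forall>w. (v, w) \<notin> E} = {t}"
    by (simp_all add: V_def)
  have up: "\<pi> u < \<pi> v" if "(u, v) \<in> E" for u v
    using st that by (auto simp: st_ordering_def E_def)
  have inj: "inj_on \<pi> V" using st by (simp add: st_ordering_def V_def)
  define su pr where "su = succs \<E>" and "pr = preds \<E>"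
  let ?I = "\<lambda>v. map (\<lambda>u. (u, v)) (pr v)" and ?O = "\<lambda>v. map (Pair v) (su v)"
  obtain p \<gamma> where draw: "upward_planar_drawing G p \<gamma>" "induces_embedding G p \<gamma> \<E>"
    using emb unfolding upward_planar_embedding_def by blast
  have su: "distinct (su v)" "set (su v) = {w. (v, w) \<in> E}"
    and pr: "distinct (pr v)" "set (pr v) = {u. (u, v) \<in> E}" if "v \<in> V" for v
    using draw(2) that unfolding induces_embedding_def su_def pr_def V_def E_def by simp_all
  obtain vs where vs: "distinct vs" "set vs = V" "sorted_wrt (\<lambda>a b. (b, a) \<notin> E) vs" "sweep ?I ?O [] vs"
    using upward_embedding_sweep[OF draw] fin EV unfolding su_def pr_def V_def E_def by blast
  obtain ws where ws: "distinct ws" "set ws = V" "sorted_wrt (\<lambda>a b. \<pi> a < \<pi> b) ws"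
    using obtain_sorted_list[OF fin inj] by blast
  have "sorted_wrt (\<lambda>a b. (\<exists>w. (a, w) \<in> E) \<and> (\<exists>u. (u, b) \<in> E)) vs"
    by (rule topological_order_interior[OF vs(3,1) _ \<open>acyclic E\<close>]) (use EV s t vs(2) in auto)
  then have interior: "sorted_wrt (\<lambda>a b. ?O a \<noteq> [] \<and> ?I b \<noteq> []) vs"
  proof (rule sorted_wrt_mono_rel[rotated])
    fix a b assume "a \<in> set vs" "b \<in> set vs" "(\<exists>w. (a, w) \<in> E) \<and> (\<exists>u. (u, b) \<in> E)"
    then have "set (su a) \<noteq> {}" "set (pr b) \<noteq> {}" using su pr vs(2) by auto
    then show "?O a \<noteq> [] \<and> ?I b \<noteq> []" by auto
  qed
  have "sorted_wrt (\<lambda>a b. set (?O b) \<inter> set (?I a) = {}) ws"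
  proof (rule sorted_wrt_mono_rel[OF _ ws(3)])
    fix a b assume "a \<in> set ws" "b \<in> set ws" "\<pi> a < \<pi> b"
    then have "(b, a) \<notin> E" using up[of b a] by auto
    then show "set (?O b) \<inter> set (?I a) = {}" using su(2) \<open>b \<in> set ws\<close> ws(2) by auto
  qed
  then have sweep: "sweep ?I ?O [] ws"
    using sweep_reorder[OF vs(4,1) ws(1) _ interior] vs(2) ws(2) by simp
  have "ws \<noteq> []" using s ws(2) by auto
  then obtain r ws' where ws': "ws = r # ws'" by (cases ws) auto
  have r: "r \<in> V" "r \<notin> set ws'" using ws ws' by auto
  have first: "(u, r) \<notin> E" for u
    using up[of u r] ws EV unfolding ws' by force
  have "r \<in> {v \<in> V. \<forall>u. (u, v) \<notin> E}" using r first by simp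
  then have "r = s" unfolding s by simp
  have filter_r: "filter (\<lambda>w. w \<noteq> r) (su r) = su r"
    using su(2)[OF r(1)] first by (auto simp: filter_id_conv)
  \<comment> \<open>The lowest vertex has no predecessor to be placed beside, so it is placed
    beforehand; its column 0 is arbitrary.\<close>
  have "\<exists>x'. (\<forall>p\<in>{r}. x' p = (\<lambda>_. 0 :: real) p) \<and> inj_on x' V \<and>
      (\<forall>e\<in>E. \<forall>f\<in>E. snd f \<in> set ws' \<longrightarrow> \<not> blocks x' \<pi> e f) \<and>
      ((\<forall>v\<in>V. mono_decreasing \<pi> (su v)) \<longrightarrow> (\<forall>(u, v)\<in>E. v \<in> set ws' \<longrightarrow> x' u < x' v))"
  proof (rule sweep_imp_columns)
    show "sweep ?I ?O (?O r) ws'"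
      using sweep pr(2)[OF r(1)] first unfolding ws' by auto
    show "\<forall>v\<in>set ws'. pr v \<noteq> []"
    proof
      fix v assume v: "v \<in> set ws'"
      then have "v \<in> V" "v \<noteq> s" using ws(2) r \<open>r = s\<close> unfolding ws' by auto
      then obtain u where "(u, v) \<in> E" using s by blast
      then show "pr v \<noteq> []" using pr(2)[OF \<open>v \<in> V\<close>] by auto
    qed
    show "\<forall>u\<in>{r}. filter (\<lambda>e. fst e = u) (?O r) = map (Pair u) (filter (\<lambda>w. w \<notin> {r}) (su u))"
      using filter_r by (simp add: filter_map comp_def)
    show "sorted (map ((\<lambda>_. 0 :: real) \<circ> fst) (?O r))"
      by (simp add: sorted_wrt_iff_nth_less)
    show "\<forall>v\<in>V. distinct (su v) \<and> set (su v) = {w. (v, w) \<in> E} \<and> bitonic \<pi> (su v)"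
      using su bit by (simp add: V_def su_def)
    show "\<forall>v\<in>V. distinct (pr v) \<and> set (pr v) = {u. (u, v) \<in> E}"
      using pr by simp
    show "V = {r} \<union> set ws'" using ws(2) ws' by auto
    show "\<forall>(u, v)\<in>E. \<pi> u < \<pi> v" using up by auto
    show "\<forall>p\<in>{r}. \<forall>w\<in>set ws'. \<pi> p < \<pi> w" "sorted_wrt (\<lambda>a b. \<pi> a < \<pi> b) ws'"
      using ws(3) ws' by auto
    show "distinct ws'" using ws(1) ws' by auto
  qed (use EV r in auto)
  then obtain x where x: "inj_on x V" "\<forall>e\<in>E. \<forall>f\<in>E. snd f \<in> set ws' \<longrightarrow> \<not> blocks x \<pi> e f"
    "(\<forall>v\<in>V. mono_decreasing \<pi> (su v)) \<longrightarrow> (\<forall>(u, v)\<in>E. v \<in> set ws' \<longrightarrow> x u < (x v :: real))"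
    by (elim exE conjE) (rule that)
  \<comment> \<open>No edge enters the lowest vertex, so what was shown for heads in
    \<open>ws'\<close> covers all edges.\<close>
  have head: "snd e \<in> set ws'" if "e \<in> E" for e
    using that first[of "fst e"] EV ws(2) unfolding ws' by (cases e) auto
  obtain r :: "'a \<Rightarrow> int" where r: "\<forall>u\<in>V. \<forall>v\<in>V. r u < r v \<longleftrightarrow> x u < x v"
    using int_ranks[OF fin] by blast
  have "inj_on r V"
  proof (rule inj_onI)
    fix u v assume uv: "u \<in> V" "v \<in> V" "r u = r v"
    then have "\<not> x u < x v" "\<not> x v < x u" using r by force+
    then show "u = v" using uv x(1) by (auto dest: inj_onD)
  qed
  moreover have "\<not> blocks r \<pi> e f" if "e \<in> E" "f \<in> E" for e f
  proof -
    have "fst e \<in> V" "fst f \<in> V" "snd f \<in> V" using that EV by auto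
    then have "blocks r \<pi> e f \<longleftrightarrow> blocks x \<pi> e f" using r by (simp add: blocks_def)
    then show ?thesis using x(2) head that by blast
  qed
  moreover have "r u < r v" if "\<forall>v\<in>V. mono_decreasing \<pi> (su v)" "(u, v) \<in> E" for u v
  proof -
    have "x u < x v" using x(3) head[OF that(2)] that by auto
    then show ?thesis using r EV that(2) by auto
  qed
  ultimately show ?thesis
    by (intro exI[of _ r]) (auto simp: V_def E_def su_def)
qed

theorem theorem3:
  fixes G :: "'a pair_pre_digraph"
  assumes "planar_st_graph G"
  shows "((\<exists>x y. upward_planar_L_drawing G x y) \<longleftrightarrow> (\<exists>\<E> \<pi>. bitonic_pair G \<E> \<pi>)) \<and>
         ((\<exists>x y. upward_rightward_planar_L_drawing G x y) \<longleftrightarrow> (\<exists>\<E> \<pi>. mono_decreasing_pair G \<E> \<pi>))"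
proof -
  interpret pair_fin_digraph G using assms by (simp add: planar_st_graph_def)
  have E: "parcs G \<subseteq> pverts G \<times> pverts G"
    by (auto dest: in_arcsD1 in_arcsD2)
  have loop: "(v, v) \<notin> parcs G" for v
    using assms by (auto simp: planar_st_graph_def acyclic_def)
  note L_iff = upward_planar_L_drawing_iff[OF E loop]
    and LR_iff = upward_rightward_planar_L_drawing_iff[OF E loop]
  \<comment> \<open>One embedding serves both equivalences: in a rightward drawing no edge turns
    left, so the increasing part of each successor list is empty.\<close>
  have pair: "\<exists>\<E>. bitonic_pair G \<E> y \<and>
      ((\<forall>(u, v)\<in>parcs G. x u < x v) \<longrightarrow> mono_decreasing_pair G \<E> y)"
    if "upward_planar_L_drawing G x y" for x y
  proof -
    from that have xy: "inj_on x (pverts G)" "inj_on y (pverts G)" "\<forall>(u, v)\<in>parcs G. y u < y v"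
      "\<forall>e\<in>parcs G. \<forall>f\<in>parcs G. \<not> blocks x y e f" unfolding L_iff by blast+
    obtain \<E> where emb: "upward_planar_embedding G \<E>"
      and succs: "\<forall>v\<in>pverts G. set (succs \<E> v) = {w. (v, w) \<in> parcs G} \<and>
        sorted_wrt (\<lambda>w z. out_slope x y v w < out_slope x y v z) (succs \<E> v)"
      using L_drawing_embedding[OF pair_finite_verts E xy(3,1,2,4)] by blast
    have bitonic: "bitonic y (succs \<E> v)"
      and decreasing: "(\<forall>(u, v)\<in>parcs G. x u < x v) \<Longrightarrow> mono_decreasing y (succs \<E> v)"
      if v: "v \<in> pverts G" for v
    proof -
      have "y v < y w \<and> x w \<noteq> x v" if "w \<in> set (succs \<E> v)" for w
      proof -
        have "(v, w) \<in> parcs G" using that succs v by auto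
        then show ?thesis using xy E loop[of v] by (auto dest: inj_onD)
      qed
      moreover have "inj_on y (set (succs \<E> v))"
        by (rule inj_on_subset[OF xy(2)]) (use succs v E in auto)
      ultimately show "bitonic y (succs \<E> v)"
        "(\<forall>(u, v)\<in>parcs G. x u < x v) \<Longrightarrow> mono_decreasing y (succs \<E> v)"
        using sorted_out_slope_bitonic[of x y v "succs \<E> v"] succs v by auto
    qed
    have "st_ordering G y" using xy by (simp add: st_ordering_def)
    then show ?thesis
      using emb bitonic decreasing unfolding bitonic_pair_def mono_decreasing_pair_def by blast
  qed
  have drawing: "\<exists>x. upward_planar_L_drawing G x \<pi> \<and>
      (mono_decreasing_pair G \<E> \<pi> \<longrightarrow> upward_rightward_planar_L_drawing G x \<pi>)"
    if "bitonic_pair G \<E> \<pi>" for \<E> \<pi>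
  proof -
    have emb: "upward_planar_embedding G \<E>" "st_ordering G \<pi>"
      "\<forall>v\<in>pverts G. bitonic \<pi> (succs \<E> v)" using that by (auto simp: bitonic_pair_def)
    from bitonic_pair_columns[OF assms this] obtain x :: "'a \<Rightarrow> int" where
      "inj_on x (pverts G)" "\<forall>e\<in>parcs G. \<forall>f\<in>parcs G. \<not> blocks x \<pi> e f"
      "(\<forall>v\<in>pverts G. mono_decreasing \<pi> (succs \<E> v)) \<longrightarrow> (\<forall>(u, v)\<in>parcs G. x u < x v)" by blast
    then show ?thesis
      using emb(2) unfolding LR_iff L_iff st_ordering_def mono_decreasing_pair_def by blast
  qed
  have "bitonic_pair G \<E> \<pi>" if "mono_decreasing_pair G \<E> \<pi>" for \<E> \<pi>
    using that by (auto simp: bitonic_pair_def mono_decreasing_pair_def mono_decreasing_imp_bitonic)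
  then show ?thesis
    using pair drawing unfolding LR_iff by blast
qed

end
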